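(* Let $(X_{it})_{i,t\ge1}$ be independent and identically distributed real random variables, let $f:\mathbb{R}^2\to\mathbb{R}$ be measurable with $f(x,y)=f(y,x)$ and $0<\operatorname{Var}(f(X_{11},X_{21}))<\infty$, and let $T_{ij}$, $Z$ and $\rho$ be as defined in the context. Let $p=p_n$ be an integer sequence with $p_n\to\infty$ and $\tilde p=p(p-1)/2$. Assume that there exist constants $\eta,c,C>0$ such that $$\mathbb{E}[\exp(\eta|Z|)]<\infty\qquad\text{and}\qquad\frac{(\log(\tilde pn))^7}{n}\le Cn^{-c}.$$ Then, for all $\rho\in[0,1/2]$, as $n\to\infty$, $$\max_{1\le i<j\le p}\frac1{\sqrt{\log p}}\,T_{ij}\to2\quad\text{in probability.}$$
   Context: For $1\le i<j\le p$ and $l\ge1$, $$Z_{i,j,l}=\frac{f(X_{il},X_{jl})-\mathbb{E}[f(X_{11},X_{21})]}{\sqrt{\operatorname{Var}(f(X_{11},X_{21}))}},\qquad T_{ij}=\frac1{\sqrt n}\sum_{l=1}^nZ_{i,j,l},$$ $Z$ is a random variable with the distribution of $Z_{1,2,1}$, and $\rho=\mathbb{E}[Z_{1,2,1}Z_{1,3,1}]=\operatorname{Corr}(f(X_{11},X_{21}),f(X_{11},X_{31}))$; the possible values of $\rho$ all lie in $[0,1/2]$. *)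

theory Defs
  imports "HOL-Probability.Probability"
begin

text \<open>The function \<open>f\<close> of two real variables is represented as \<open>f :: real \<times> real \<Rightarrow> real\<close>; the
  doubly indexed family \<open>X i t\<close> is only meaningful for \<open>i, t \<ge> 1\<close>.\<close>

definition iid_array :: "'a measure \<Rightarrow> (nat \<Rightarrow> nat \<Rightarrow> 'a \<Rightarrow> real) \<Rightarrow> bool" where
  "iid_array M X \<longleftrightarrow>
     prob_space.indep_vars M (\<lambda>_. borel) (\<lambda>(i, t). X i t) ({1..} \<times> {1..}) \<and>
     (\<forall>i\<ge>1. \<forall>t\<ge>1. distr M borel (X i t) = distr M borel (X 1 1))"

definition Zvar :: "'a measure \<Rightarrow> (real \<times> real \<Rightarrow> real) \<Rightarrow> (nat \<Rightarrow> nat \<Rightarrow> 'a \<Rightarrow> real)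
    \<Rightarrow> nat \<Rightarrow> nat \<Rightarrow> nat \<Rightarrow> 'a \<Rightarrow> real" where
  "Zvar M f X i j l \<omega> =
     (f (X i l \<omega>, X j l \<omega>) - prob_space.expectation M (\<lambda>\<omega>. f (X 1 1 \<omega>, X 2 1 \<omega>)))
       / sqrt (prob_space.variance M (\<lambda>\<omega>. f (X 1 1 \<omega>, X 2 1 \<omega>)))"

definition Tstat :: "'a measure \<Rightarrow> (real \<times> real \<Rightarrow> real) \<Rightarrow> (nat \<Rightarrow> nat \<Rightarrow> 'a \<Rightarrow> real)
    \<Rightarrow> nat \<Rightarrow> nat \<Rightarrow> nat \<Rightarrow> 'a \<Rightarrow> real" where
  "Tstat M f X n i j \<omega> = 1 / sqrt (real n) * (\<Sum>l = 1..n. Zvar M f X i j l \<omega>)"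

definition rho :: "'a measure \<Rightarrow> (real \<times> real \<Rightarrow> real) \<Rightarrow> (nat \<Rightarrow> nat \<Rightarrow> 'a \<Rightarrow> real) \<Rightarrow> real" where
  "rho M f X = prob_space.expectation M (\<lambda>\<omega>. Zvar M f X 1 2 1 \<omega> * Zvar M f X 1 3 1 \<omega>)"

text \<open>Measurability is part of the notion, since \<open>measure\<close> returns 0 on non-measurable sets.\<close>

definition tendsto_in_prob :: "'a measure \<Rightarrow> (nat \<Rightarrow> 'a \<Rightarrow> real) \<Rightarrow> real \<Rightarrow> bool" where
  "tendsto_in_prob M Y c \<longleftrightarrow>
     (\<forall>n. Y n \<in> borel_measurable M) \<and>
     (\<forall>\<epsilon>>0. (\<lambda>n. measure M {\<omega> \<in> space M. \<bar>Y n \<omega> - c\<bar> > \<epsilon>}) \<longlonglongrightarrow> 0)"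

end

theory Submission
  imports Defs "HOL-Real_Asymp.Real_Asymp"
begin

text \<open>
  Put \<open>L = ln p\<close> and \<open>S\<^sub>i\<^sub>j = sqrt L * T\<^sub>i\<^sub>j\<close>, which is \<open>sqrt (L / n)\<close> times a sum of \<open>n\<close> independent
  copies of the standardised kernel \<open>z\<close>. The claim is that the maximum of \<open>S\<^sub>i\<^sub>j\<close> is close to \<open>2 L\<close>.
  The growth condition on \<open>p\<close> gives \<open>L / n \<rightarrow> 0\<close>, so the
  factor \<open>sqrt (L / n)\<close> tends to zero, and an exponential moment of a centred variable \<open>U\<close> of
  variance \<open>V\<close> gives \<open>E exp (sqrt (L / n) * (U\<^sub>1 + ... + U\<^sub>n)) = exp ((V / 2 + o(1)) L)\<close>, as in the
  Gaussian case (\<open>exp_moment_growth\<close>). All probabilities below are powers of \<open>p\<close> up to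
  \<open>p\<close> to the power \<open>o(1)\<close>, and these asymptotics determine the exponents.

  Upper bound. Each \<open>S\<^sub>i\<^sub>j\<close> exceeds \<open>(2 + \<delta>) L\<close> with probability at most \<open>exp (- (2 + \<delta>) L)\<close> by the
  Chernoff bound with parameter 2, and there are at most \<open>exp (2 L)\<close> pairs (\<open>max_upper\<close>).

  Lower bound. Pairs without a common index are independent, so the second moment method
  applies to the number of pairs with \<open>S\<^sub>i\<^sub>j \<ge> (2 - \<epsilon>) L\<close>, except that for large \<open>\<rho>\<close> the pairs sharing an index
  contribute too much: \<open>P(S\<^sub>1\<^sub>2, S\<^sub>1\<^sub>3 \<ge> x L)\<close> is of order \<open>exp (- x\<^sup>2 L / (1 + \<rho>))\<close>, which is too big when
  \<open>\<rho> > 1/3\<close>. The excess comes from atypically large values of the projection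
  \<open>\<Gamma>\<^sub>i = sqrt (L / n) * (\<Sum>l. g (X\<^sub>i\<^sub>l))\<close>, where \<open>g x = E z (x, X)\<close> has variance \<open>\<rho>\<close>. Given \<open>S\<^sub>1\<^sub>2 = \<theta> L\<close>, the typical value
  of \<open>\<Gamma>\<^sub>1\<close> is \<open>\<rho> \<theta> L\<close>, so one counts only pairs with
  \<open>\<Gamma>\<^sub>i, \<Gamma>\<^sub>j \<le> (\<rho> \<theta> + \<delta>) L\<close> (the events \<open>good\<close>). This truncation does not change the exponent
  \<open>- \<theta>\<^sup>2 / 2\<close> of a single event (\<open>good_prob_lower\<close>), but lowers the exponent of two events with a
  common index to \<open>- \<theta>\<^sup>2 (1 - \<rho> / 2)\<close> (\<open>good_overlap_upper\<close>). With about \<open>p\<^sup>2\<close> pairs and \<open>p\<^sup>3\<close>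
  overlapping pairs of pairs, the second moment method needs \<open>2 - \<theta>\<^sup>2 / 2 > 0\<close> and
  \<open>1 - \<theta>\<^sup>2 \<rho> / 2 > 0\<close>; both hold for all \<open>\<theta> < 2\<close> as \<open>\<rho> \<le> 1/2\<close> (\<open>max_lower\<close>).
\<close>

section \<open>Moment generating functions, tail bounds and the second moment method\<close>

lemma exp_minus_affine_bounds:
  fixes y :: real
  shows "0 \<le> exp y - 1 - y" and "exp y - 1 - y \<le> y\<^sup>2 * exp \<bar>y\<bar>"
proof -
  show "0 \<le> exp y - 1 - y" using exp_ge_add_one_self[of y] by linarith
  obtain t where t: "\<bar>t\<bar> \<le> \<bar>y\<bar>" "exp y = (\<Sum>m<2. y ^ m / fact m) + exp t / fact 2 * y ^ 2"
    using Maclaurin_exp_le[of y 2] by blast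
  have "exp y - 1 - y = exp t / 2 * y\<^sup>2" using t(2) by (simp add: numeral_2_eq_2)
  also have "\<dots> \<le> exp \<bar>y\<bar> * y\<^sup>2"
  proof (rule mult_right_mono)
    have "exp t \<le> exp \<bar>y\<bar>" using t(1) by simp
    then show "exp t / 2 \<le> exp \<bar>y\<bar>" using exp_gt_zero[of t] by linarith
  qed simp
  finally show "exp y - 1 - y \<le> y\<^sup>2 * exp \<bar>y\<bar>" by (simp add: mult.commute)
qed

lemma sq_le_exp_abs: fixes y :: real shows "y\<^sup>2 \<le> 2 * exp \<bar>y\<bar>"
  using exp_lower_Taylor_quadratic[of "\<bar>y\<bar>"] by simp

text \<open>An integrable majorant for the second-order remainder of \<open>exp (s * u)\<close>, uniform in small \<open>s\<close>.\<close>

lemma sq_mult_exp_le: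
  fixes u h s :: real
  assumes "h > 0" "\<bar>s\<bar> \<le> h / 2"
  shows "u\<^sup>2 * exp \<bar>s * u\<bar> \<le> 8 / h\<^sup>2 * exp (h * \<bar>u\<bar>)"
proof -
  have "(h / 2 * u)\<^sup>2 \<le> 2 * exp (h / 2 * \<bar>u\<bar>)"
    using sq_le_exp_abs[of "h / 2 * u"] assms by (simp add: abs_mult)
  then have 1: "u\<^sup>2 \<le> 8 / h\<^sup>2 * exp (h / 2 * \<bar>u\<bar>)"
    using assms by (simp add: field_simps power2_eq_square)
  have 2: "exp \<bar>s * u\<bar> \<le> exp (h / 2 * \<bar>u\<bar>)"
    using mult_right_mono[OF assms(2), of "\<bar>u\<bar>"] by (simp add: abs_mult)
  have "u\<^sup>2 * exp \<bar>s * u\<bar> \<le> (8 / h\<^sup>2 * exp (h / 2 * \<bar>u\<bar>)) * exp (h / 2 * \<bar>u\<bar>)"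
    by (rule mult_mono[OF 1 2]) auto
  also have "\<dots> = 8 / h\<^sup>2 * exp (h * \<bar>u\<bar>)"
    by (simp add: mult.assoc mult_exp_exp)
  finally show ?thesis .
qed

context prob_space
begin

lemma integrable_powers_of_exp_moment:
  fixes U :: "'a \<Rightarrow> real"
  assumes [measurable]: "U \<in> borel_measurable M" and h: "h > 0"
    and e: "integrable M (\<lambda>x. exp (h * \<bar>U x\<bar>))"
  shows "integrable M U" and "integrable M (\<lambda>x. (U x)\<^sup>2)"
    and "\<bar>s\<bar> \<le> h \<Longrightarrow> integrable M (\<lambda>x. exp (s * U x))"
proof -
  show 2: "integrable M (\<lambda>x. (U x)\<^sup>2)"
  proof (rule Bochner_Integration.integrable_bound)
    show "integrable M (\<lambda>x. 8 / h\<^sup>2 * exp (h * \<bar>U x\<bar>))" using e by simp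
    show "AE x in M. norm ((U x)\<^sup>2) \<le> norm (8 / h\<^sup>2 * exp (h * \<bar>U x\<bar>))"
      using sq_mult_exp_le[OF h, of 0] h by (auto simp: abs_mult)
  qed measurable
  show "integrable M U"
    by (rule square_integrable_imp_integrable[OF _ 2]) auto
  show "integrable M (\<lambda>x. exp (s * U x))" if s: "\<bar>s\<bar> \<le> h"
  proof (rule Bochner_Integration.integrable_bound[OF e])
    have "s * u \<le> h * \<bar>u\<bar>" for u
      using mult_right_mono[OF s, of "\<bar>u\<bar>"] abs_ge_self[of "s * u"] by (simp add: abs_mult)
    then show "AE x in M. norm (exp (s * U x)) \<le> norm (exp (h * \<bar>U x\<bar>))" by simp
  qed measurable
qed

lemma exp_moment_ge_one:
  fixes U :: "'a \<Rightarrow> real"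
  assumes "integrable M U" "integrable M (\<lambda>x. exp (s * U x))" "expectation U = 0"
  shows "1 \<le> expectation (\<lambda>x. exp (s * U x))"
proof -
  have "expectation (\<lambda>x. 1 + s * U x) \<le> expectation (\<lambda>x. exp (s * U x))"
    using assms by (intro integral_mono) (auto simp: exp_ge_add_one_self)
  then show ?thesis using assms by (simp add: prob_space)
qed

text \<open>Dominated convergence in the second-order remainder of the exponential.\<close>

lemma moment_generating_function_second_order:
  fixes U :: "'a \<Rightarrow> real"
  assumes U[measurable]: "U \<in> borel_measurable M" and h: "h > 0"
    and e: "integrable M (\<lambda>x. exp (h * \<bar>U x\<bar>))" and c: "expectation U = 0"
  shows "((\<lambda>s. (expectation (\<lambda>x. exp (s * U x)) - 1) / s\<^sup>2)
           \<longlongrightarrow> expectation (\<lambda>x. (U x)\<^sup>2) / 2) (at 0)"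
  unfolding tendsto_at_iff_sequentially comp_def
proof (intro allI impI)
  note int = integrable_powers_of_exp_moment[OF U h e]
  fix S :: "nat \<Rightarrow> real" assume S: "\<forall>i. S i \<in> UNIV - {0}" "S \<longlonglongrightarrow> 0"
  have "\<forall>\<^sub>F i in sequentially. \<bar>S i\<bar> < h / 2"
    using order_tendstoD(2)[OF tendsto_rabs_zero[OF S(2)], of "h / 2"] h by simp
  then obtain k where k: "\<And>i. i \<ge> k \<Longrightarrow> \<bar>S i\<bar> < h / 2" by (auto simp: eventually_sequentially)
  define r where "r s u = (exp (s * u) - 1 - s * u) / s\<^sup>2" for s u :: real
  have "(\<lambda>i. expectation (\<lambda>x. r (S (i + k)) (U x))) \<longlonglongrightarrow> expectation (\<lambda>x. (U x)\<^sup>2 / 2)"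
  proof (rule integral_dominated_convergence[where w = "\<lambda>x. 8 / h\<^sup>2 * exp (h * \<bar>U x\<bar>)"])
    show "AE x in M. (\<lambda>i. r (S (i + k)) (U x)) \<longlonglongrightarrow> (U x)\<^sup>2 / 2"
    proof (rule AE_I2)
      fix x
      have "((\<lambda>s. (exp (s * u) - 1 - s * u) / s\<^sup>2) \<longlongrightarrow> u\<^sup>2 / 2) (at 0)" for u :: real
        by real_asymp (simp_all add: power2_eq_square)
      then have "((\<lambda>s. r s (U x)) \<longlongrightarrow> (U x)\<^sup>2 / 2) (at 0)" by (simp add: r_def)
      moreover have "filterlim (\<lambda>i. S (i + k)) (at 0) sequentially"
        using S LIMSEQ_ignore_initial_segment[OF S(2), of k] by (simp add: filterlim_at)
      ultimately show "(\<lambda>i. r (S (i + k)) (U x)) \<longlonglongrightarrow> (U x)\<^sup>2 / 2"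
        by (rule filterlim_compose)
    qed
    show "AE x in M. norm (r (S (i + k)) (U x)) \<le> 8 / h\<^sup>2 * exp (h * \<bar>U x\<bar>)" for i
    proof (rule AE_I2)
      fix x
      define s where "s = S (i + k)"
      have s: "\<bar>s\<bar> \<le> h / 2" "s \<noteq> 0" using k[of "i + k"] S by (auto simp: s_def)
      have "norm (r s (U x)) = r s (U x)"
        using exp_minus_affine_bounds(1)[of "s * U x"] by (simp add: r_def)
      also have "\<dots> \<le> (s * U x)\<^sup>2 * exp \<bar>s * U x\<bar> / s\<^sup>2"
        unfolding r_def by (intro divide_right_mono exp_minus_affine_bounds) simp
      also have "\<dots> = (U x)\<^sup>2 * exp \<bar>s * U x\<bar>" using s by (simp add: power_mult_distrib)
      also have "\<dots> \<le> 8 / h\<^sup>2 * exp (h * \<bar>U x\<bar>)" by (rule sq_mult_exp_le[OF h s(1)])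
      finally show "norm (r (S (i + k)) (U x)) \<le> 8 / h\<^sup>2 * exp (h * \<bar>U x\<bar>)"
        by (simp add: s_def)
    qed
  qed (use e in \<open>auto simp: r_def\<close>)
  moreover have "expectation (\<lambda>x. r (S (i + k)) (U x))
      = (expectation (\<lambda>x. exp (S (i + k) * U x)) - 1) / (S (i + k))\<^sup>2" for i
    using int(1) int(3)[of "S (i + k)"] k[of "i + k"] c h by (simp add: r_def prob_space)
  ultimately show "(\<lambda>i. (expectation (\<lambda>x. exp (S i * U x)) - 1) / (S i)\<^sup>2)
      \<longlonglongrightarrow> expectation (\<lambda>x. (U x)\<^sup>2) / 2"
    by (simp add: LIMSEQ_offset[where k = k])
qed

text \<open>Writing the moment generating function as \<open>1 + y\<close> with \<open>y = s\<^sup>2 * r s \<ge> 0\<close>, the inequalities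
  \<open>y - y\<^sup>2 \<le> ln (1 + y) \<le> y\<close> enclose the logarithm. Both bounds stay
  meaningful when the variance vanishes and \<open>y\<close> may be zero, where the quotient \<open>ln (1 + y) / y\<close> would not.\<close>

lemma cumulant_generating_function_second_order:
  fixes U :: "'a \<Rightarrow> real"
  assumes U[measurable]: "U \<in> borel_measurable M" and h: "h > 0"
    and e: "integrable M (\<lambda>x. exp (h * \<bar>U x\<bar>))" and c: "expectation U = 0"
  shows "((\<lambda>s. ln (expectation (\<lambda>x. exp (s * U x))) / s\<^sup>2)
           \<longlongrightarrow> expectation (\<lambda>x. (U x)\<^sup>2) / 2) (at 0)"
proof -
  define \<phi> where "\<phi> s = expectation (\<lambda>x. exp (s * U x))" for s
  define r where "r s = (\<phi> s - 1) / s\<^sup>2" for s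
  have r: "(r \<longlongrightarrow> expectation (\<lambda>x. (U x)\<^sup>2) / 2) (at 0)"
    using moment_generating_function_second_order[OF assms] by (simp add: r_def[abs_def] \<phi>_def)
  have "((\<lambda>s. s\<^sup>2 * r s) \<longlongrightarrow> 0\<^sup>2 * (expectation (\<lambda>x. (U x)\<^sup>2) / 2)) (at 0)"
    by (intro tendsto_intros r)
  then have sr: "((\<lambda>s. s\<^sup>2 * r s) \<longlongrightarrow> 0) (at 0)" by simp
  have ev: "\<forall>\<^sub>F s in at 0. s \<noteq> 0 \<and> \<bar>s\<bar> \<le> h \<and> s\<^sup>2 * r s < 1"
  proof (intro eventually_conj)
    show "\<forall>\<^sub>F s in at 0. s \<noteq> (0::real)" by (simp add: eventually_at_filter)
    show "\<forall>\<^sub>F s in at 0. \<bar>s\<bar> \<le> h" using h by (auto simp: eventually_at dist_norm intro!: exI[of _ h])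
    show "\<forall>\<^sub>F s in at 0. s\<^sup>2 * r s < 1" using order_tendstoD(2)[OF sr] by simp
  qed
  have main: "r s - s\<^sup>2 * (r s)\<^sup>2 \<le> ln (\<phi> s) / s\<^sup>2 \<and> ln (\<phi> s) / s\<^sup>2 \<le> r s"
    if "s \<noteq> 0 \<and> \<bar>s\<bar> \<le> h \<and> s\<^sup>2 * r s < 1" for s
  proof -
    have y: "\<phi> s = 1 + s\<^sup>2 * r s" using that by (simp add: r_def)
    have "1 \<le> \<phi> s" unfolding \<phi>_def
      using integrable_powers_of_exp_moment[OF U h e] c that by (intro exp_moment_ge_one) auto
    then have 0: "0 \<le> s\<^sup>2 * r s" using y by simp
    have "s\<^sup>2 * r s - (s\<^sup>2 * r s)\<^sup>2 \<le> ln (\<phi> s)" "ln (\<phi> s) \<le> s\<^sup>2 * r s"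
      unfolding y using 0 that
      by (auto intro!: ln_one_plus_pos_lower_bound ln_add_one_self_le_self)
    then have "(s\<^sup>2 * r s - (s\<^sup>2 * r s)\<^sup>2) / s\<^sup>2 \<le> ln (\<phi> s) / s\<^sup>2"
      "ln (\<phi> s) / s\<^sup>2 \<le> s\<^sup>2 * r s / s\<^sup>2"
      by (intro divide_right_mono; simp)+
    moreover have "(s\<^sup>2 * r s - (s\<^sup>2 * r s)\<^sup>2) / s\<^sup>2 = r s - s\<^sup>2 * (r s)\<^sup>2"
      using that by (simp add: diff_divide_distrib power_mult_distrib power2_eq_square)
    ultimately show ?thesis using that by simp
  qed
  have "((\<lambda>s. ln (\<phi> s) / s\<^sup>2) \<longlongrightarrow> expectation (\<lambda>x. (U x)\<^sup>2) / 2) (at 0)"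
  proof (rule tendsto_sandwich)
    show "\<forall>\<^sub>F s in at 0. r s - s\<^sup>2 * (r s)\<^sup>2 \<le> ln (\<phi> s) / s\<^sup>2"
      using ev by eventually_elim (use main in blast)
    show "\<forall>\<^sub>F s in at 0. ln (\<phi> s) / s\<^sup>2 \<le> r s"
      using ev by eventually_elim (use main in blast)
    have "((\<lambda>s. r s - s\<^sup>2 * (r s)\<^sup>2) \<longlongrightarrow> expectation (\<lambda>x. (U x)\<^sup>2) / 2
        - 0\<^sup>2 * (expectation (\<lambda>x. (U x)\<^sup>2) / 2)\<^sup>2) (at 0)"
      by (intro tendsto_intros r)
    then show "((\<lambda>s. r s - s\<^sup>2 * (r s)\<^sup>2) \<longlongrightarrow> expectation (\<lambda>x. (U x)\<^sup>2) / 2) (at 0)" by simp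
  qed (rule r)
  then show ?thesis by (simp add: \<phi>_def)
qed

lemma chernoff_bound:
  fixes W :: "'a \<Rightarrow> real"
  assumes "integrable M (\<lambda>x. exp (W x))" "A \<in> events" "\<And>x. x \<in> A \<Longrightarrow> w \<le> W x"
  shows "prob A \<le> exp (- w) * expectation (\<lambda>x. exp (W x))"
proof -
  have "exp w * prob A = expectation (\<lambda>x. exp w * indicator A x)" using assms(2) by simp
  also have "\<dots> \<le> expectation (\<lambda>x. exp (W x))"
    using assms by (intro integral_mono) (auto split: split_indicator simp: emeasure_eq_measure)
  finally show ?thesis by (simp add: exp_minus field_simps)
qed

text \<open>A version for a dependency graph \<open>R\<close>: Chebyshev's inequality for the number of events that occur.
  The independent pairs cancel in the variance, the diagonal gives the first summand of the bound,
  and the at most \<open>d\<close> dependent partners of each event give the second. The events may have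
  different probabilities.\<close>

lemma second_moment_method:
  fixes A :: "'e \<Rightarrow> 'a set" and d q r :: real
  assumes fin: "finite I" and ne: "I \<noteq> {}" and A[measurable]: "\<And>e. e \<in> I \<Longrightarrow> A e \<in> events"
    and ind: "\<And>e f. e \<in> I \<Longrightarrow> f \<in> I \<Longrightarrow> e \<noteq> f \<Longrightarrow> \<not> R e f \<Longrightarrow> prob (A e \<inter> A f) = prob (A e) * prob (A f)"
    and dep: "\<And>e f. e \<in> I \<Longrightarrow> f \<in> I \<Longrightarrow> e \<noteq> f \<Longrightarrow> R e f \<Longrightarrow> prob (A e \<inter> A f) \<le> r"
    and deg: "\<And>e. e \<in> I \<Longrightarrow> real (card {f\<in>I. R e f}) \<le> d"
    and q: "0 < q" "\<And>e. e \<in> I \<Longrightarrow> q \<le> prob (A e)" and r: "0 \<le> r"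
  shows "prob (space M - (\<Union>e\<in>I. A e)) \<le> 1 / (card I * q) + d * r / (card I * q\<^sup>2)"
proof -
  define m where "m = (\<Sum>e\<in>I. prob (A e))"
  define N where "N x = (\<Sum>e\<in>I. indicator (A e) x :: real)" for x
  have N[measurable]: "random_variable borel N" unfolding N_def by measurable
  have intA: "integrable M (indicator (A e) :: 'a \<Rightarrow> real)" if "e \<in> I" for e
    using A[OF that] by (simp add: emeasure_eq_measure)
  have EN: "expectation N = m"
    unfolding N_def m_def using intA A by (subst Bochner_Integration.integral_sum) auto
  have sq: "(N x)\<^sup>2 = (\<Sum>e\<in>I. \<Sum>f\<in>I. indicator (A e \<inter> A f) x)" for x
    by (simp add: N_def power2_eq_square sum_product indicator_inter_arith)
  have intAA: "integrable M (indicator (A e \<inter> A f) :: 'a \<Rightarrow> real)" if "e \<in> I" "f \<in> I" for e f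
    using A[OF that(1)] A[OF that(2)] by (simp add: emeasure_eq_measure sets.Int)
  have int2: "integrable M (\<lambda>x. (N x)\<^sup>2)" unfolding sq
    by (intro Bochner_Integration.integrable_sum intAA)
  have "expectation (\<lambda>x. (N x)\<^sup>2) = (\<Sum>e\<in>I. \<Sum>f\<in>I. prob (A e \<inter> A f))" unfolding sq
    using intAA A by (simp add: Bochner_Integration.integral_sum sets.Int)
  also have "\<dots> \<le> (\<Sum>e\<in>I. (\<Sum>f\<in>I. prob (A e) * prob (A f)) + prob (A e) + d * r)"
  proof (rule sum_mono)
    fix e assume e: "e \<in> I"
    have "(\<Sum>f\<in>I. prob (A e \<inter> A f))
        \<le> (\<Sum>f\<in>I. prob (A e) * prob (A f) + (if f = e then prob (A e) else 0)
             + (if R e f then r else 0))"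
    proof (rule sum_mono)
      fix f assume f: "f \<in> I"
      consider "f = e" | "f \<noteq> e" "R e f" | "f \<noteq> e" "\<not> R e f" by blast
      then show "prob (A e \<inter> A f) \<le> prob (A e) * prob (A f) + (if f = e then prob (A e) else 0)
             + (if R e f then r else 0)"
      proof cases
        case 1 then show ?thesis using r by simp
      next
        case 2 then show ?thesis using dep[OF e f] measure_nonneg[of M "A e"] measure_nonneg[of M "A f"]
          by (auto intro: add_increasing)
      next
        case 3 then show ?thesis using ind[OF e f] by simp
      qed
    qed
    also have "\<dots> = (\<Sum>f\<in>I. prob (A e) * prob (A f)) + prob (A e) + card {f\<in>I. R e f} * r"
      using fin e by (simp add: sum.distrib sum.inter_filter[symmetric])
    also have "\<dots> \<le> (\<Sum>f\<in>I. prob (A e) * prob (A f)) + prob (A e) + d * r"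
      using mult_right_mono[OF deg[OF e] r] by simp
    finally show "(\<Sum>f\<in>I. prob (A e \<inter> A f)) \<le> (\<Sum>f\<in>I. prob (A e) * prob (A f)) + prob (A e) + d * r" .
  qed
  also have "\<dots> = m\<^sup>2 + m + card I * (d * r)"
    by (simp add: m_def sum.distrib power2_eq_square sum_product)
  finally have E2: "expectation (\<lambda>x. (N x)\<^sup>2) \<le> m\<^sup>2 + m + card I * (d * r)" .
  have cI: "0 < card I" using fin ne by (simp add: card_gt_0_iff)
  have "(\<Sum>e\<in>I. q) \<le> m" unfolding m_def using q by (intro sum_mono) auto
  then have mq: "card I * q \<le> m" by simp
  have cq: "0 < card I * q" using cI q by simp
  then have m0: "0 < m" using mq by linarith
  have "variance N = expectation (\<lambda>x. (N x)\<^sup>2) - m\<^sup>2"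
    using variance_eq[OF square_integrable_imp_integrable[OF N int2] int2] by (simp add: EN)
  then have var: "variance N \<le> m + card I * (d * r)" using E2 by simp
  have "d * r \<ge> 0"
  proof -
    obtain e where "e \<in> I" using ne by blast
    from deg[OF this] have "0 \<le> d" using of_nat_0_le_iff order_trans by blast
    then show ?thesis using r by simp
  qed
  then have dr: "0 \<le> card I * (d * r)" by simp
  have "prob (space M - (\<Union>e\<in>I. A e)) \<le> prob {x\<in>space M. \<bar>N x - expectation N\<bar> \<ge> m}"
  proof (rule finite_measure_mono)
    show "space M - (\<Union>e\<in>I. A e) \<subseteq> {x\<in>space M. \<bar>N x - expectation N\<bar> \<ge> m}"
      using m0 by (auto simp: EN N_def indicator_def)
  qed measurable
  also have "\<dots> \<le> variance N / m\<^sup>2"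
    by (rule Chebyshev_inequality[OF N int2 m0])
  also have "\<dots> \<le> (m + card I * (d * r)) / m\<^sup>2" using var by (intro divide_right_mono) auto
  also have "\<dots> = 1 / m + card I * (d * r) / m\<^sup>2" using m0 by (simp add: add_divide_distrib power2_eq_square)
  also have "\<dots> \<le> 1 / (card I * q) + card I * (d * r) / (card I * q)\<^sup>2"
    using mq cq m0 dr cI q(1) by (intro add_mono divide_left_mono power_mono mult_pos_pos) auto
  also have "card I * (d * r) / (card I * q)\<^sup>2 = d * r / (card I * q\<^sup>2)"
    using cI q by (simp add: field_simps power2_eq_square)
  finally show ?thesis .
qed

end

section \<open>The projection of a standardised kernel\<close>

text \<open>A symmetric kernel with mean 0, variance 1 and an exponential moment under
  \<open>\<mu> \<Otimes>\<^sub>M \<mu>\<close>, where \<open>\<mu>\<close> is the law of a single entry.\<close>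

locale standardised_kernel = prob_space \<mu> for \<mu> :: "real measure" +
  fixes z :: "real \<times> real \<Rightarrow> real" and h :: real
  assumes sets_\<mu>[measurable_cong, simp]: "sets \<mu> = sets borel"
    and z_measurable[measurable]: "z \<in> borel_measurable borel"
    and z_sym: "z (x, y) = z (y, x)"
    and h_pos: "h > 0"
    and z_exp: "integrable (\<mu> \<Otimes>\<^sub>M \<mu>) (\<lambda>v. exp (h * \<bar>z v\<bar>))"
    and z_mean: "(\<integral>v. z v \<partial>(\<mu> \<Otimes>\<^sub>M \<mu>)) = 0"
    and z_var: "(\<integral>v. (z v)\<^sup>2 \<partial>(\<mu> \<Otimes>\<^sub>M \<mu>)) = 1"
begin

text \<open>The first Hoeffding projection of the kernel, that is, its conditional expectation given the
  first argument.\<close>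

definition g :: "real \<Rightarrow> real" where "g x = (\<integral>y. z (x, y) \<partial>\<mu>)"

text \<open>Also the covariance of \<open>z (x, y)\<close> and \<open>z (x, w)\<close> for independent \<open>x, y, w\<close>, by Fubini's theorem
  (see \<open>comb_covariances\<close>).\<close>

definition \<rho> :: real where "\<rho> = (\<integral>x. (g x)\<^sup>2 \<partial>\<mu>)"

abbreviation Q where "Q \<equiv> \<mu> \<Otimes>\<^sub>M (\<mu> \<Otimes>\<^sub>M \<mu>)"

text \<open>All exponential moments that are needed are those of these combinations of two kernel values
  with a common argument and the projection at that argument.\<close>

definition comb :: "real \<Rightarrow> real \<Rightarrow> real \<Rightarrow> real \<times> real \<times> real \<Rightarrow> real" where
  "comb \<alpha> \<beta> \<gamma> = (\<lambda>(x, y, w). \<alpha> * z (x, y) + \<beta> * z (x, w) + \<gamma> * g x)"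

sublocale P: pair_prob_space \<mu> \<mu> ..
sublocale Q: pair_prob_space \<mu> "\<mu> \<Otimes>\<^sub>M \<mu>" ..

lemma space_\<mu>[simp]: "space \<mu> = UNIV"
  using sets_eq_imp_space_eq[OF sets_\<mu>] by simp

lemma z_measurable_pair[measurable]: "z \<in> borel_measurable (\<mu> \<Otimes>\<^sub>M \<mu>)"
proof -
  have "sets (\<mu> \<Otimes>\<^sub>M \<mu>) = sets (borel :: (real \<times> real) measure)"
    unfolding borel_prod[symmetric] by (rule sets_pair_measure_cong) simp_all
  then show ?thesis using z_measurable measurable_cong_sets by blast
qed

lemma g_measurable[measurable]: "g \<in> borel_measurable borel"
proof -
  have "g \<in> borel_measurable \<mu>" unfolding g_def by measurable
  then show ?thesis using measurable_cong_sets[OF sets_\<mu> refl] by blast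
qed

lemma comb_measurable[measurable]: "comb \<alpha> \<beta> \<gamma> \<in> borel_measurable Q"
  unfolding comb_def by measurable

text \<open>The two-dimensional marginals of \<open>Q\<close> that contain the common argument are \<open>\<mu> \<Otimes>\<^sub>M \<mu>\<close>.\<close>

lemma distr_Q_12: "distr Q (\<mu> \<Otimes>\<^sub>M \<mu>) (\<lambda>(x, y, w). (x, y)) = \<mu> \<Otimes>\<^sub>M \<mu>"
proof (rule pair_measure_eqI[symmetric])
  fix A B assume A: "A \<in> sets \<mu>" and B: "B \<in> sets \<mu>"
  have "(\<lambda>(x, y, w). (x, y)) -` (A \<times> B) \<inter> space Q = A \<times> (B \<times> space \<mu>)"
    using sets.sets_into_space[OF A] sets.sets_into_space[OF B] by (auto simp: space_pair_measure)
  then show "emeasure \<mu> A * emeasure \<mu> B = emeasure (distr Q (\<mu> \<Otimes>\<^sub>M \<mu>) (\<lambda>(x, y, w). (x, y))) (A \<times> B)"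
    using A B by (simp add: emeasure_distr emeasure_pair_measure_Times
        P.emeasure_pair_measure_Times emeasure_space_1[unfolded space_\<mu>])
qed (auto intro: sigma_finite_measure_axioms)

lemma distr_Q_13: "distr Q (\<mu> \<Otimes>\<^sub>M \<mu>) (\<lambda>(x, y, w). (x, w)) = \<mu> \<Otimes>\<^sub>M \<mu>"
proof (rule pair_measure_eqI[symmetric])
  fix A B assume A: "A \<in> sets \<mu>" and B: "B \<in> sets \<mu>"
  have "(\<lambda>(x, y, w). (x, w)) -` (A \<times> B) \<inter> space Q = A \<times> (space \<mu> \<times> B)"
    using sets.sets_into_space[OF A] sets.sets_into_space[OF B] by (auto simp: space_pair_measure)
  then show "emeasure \<mu> A * emeasure \<mu> B = emeasure (distr Q (\<mu> \<Otimes>\<^sub>M \<mu>) (\<lambda>(x, y, w). (x, w))) (A \<times> B)"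
    using A B by (simp add: emeasure_distr emeasure_pair_measure_Times
        P.emeasure_pair_measure_Times emeasure_space_1[unfolded space_\<mu>])
qed (auto intro: sigma_finite_measure_axioms)

lemma Q_12:
  fixes F :: "real \<times> real \<Rightarrow> real"
  assumes [measurable]: "F \<in> borel_measurable (\<mu> \<Otimes>\<^sub>M \<mu>)"
  shows "integrable Q (\<lambda>(x, y, w). F (x, y)) \<longleftrightarrow> integrable (\<mu> \<Otimes>\<^sub>M \<mu>) F"
    and "(\<integral>(x, y, w). F (x, y) \<partial>Q) = (\<integral>v. F v \<partial>(\<mu> \<Otimes>\<^sub>M \<mu>))"
proof -
  have [measurable]: "(\<lambda>(x, y, w). (x, y)) \<in> measurable Q (\<mu> \<Otimes>\<^sub>M \<mu>)" by measurable
  show "integrable Q (\<lambda>(x, y, w). F (x, y)) \<longleftrightarrow> integrable (\<mu> \<Otimes>\<^sub>M \<mu>) F"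
    by (subst (2) distr_Q_12[symmetric], subst integrable_distr_eq) (auto simp: case_prod_unfold)
  show "(\<integral>(x, y, w). F (x, y) \<partial>Q) = (\<integral>v. F v \<partial>(\<mu> \<Otimes>\<^sub>M \<mu>))"
    by (subst (2) distr_Q_12[symmetric], subst integral_distr) (auto simp: case_prod_unfold)
qed

lemma Q_13:
  fixes F :: "real \<times> real \<Rightarrow> real"
  assumes [measurable]: "F \<in> borel_measurable (\<mu> \<Otimes>\<^sub>M \<mu>)"
  shows "integrable Q (\<lambda>(x, y, w). F (x, w)) \<longleftrightarrow> integrable (\<mu> \<Otimes>\<^sub>M \<mu>) F"
    and "(\<integral>(x, y, w). F (x, w) \<partial>Q) = (\<integral>v. F v \<partial>(\<mu> \<Otimes>\<^sub>M \<mu>))"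
proof -
  have [measurable]: "(\<lambda>(x, y, w). (x, w)) \<in> measurable Q (\<mu> \<Otimes>\<^sub>M \<mu>)" by measurable
  show "integrable Q (\<lambda>(x, y, w). F (x, w)) \<longleftrightarrow> integrable (\<mu> \<Otimes>\<^sub>M \<mu>) F"
    by (subst (2) distr_Q_13[symmetric], subst integrable_distr_eq) (auto simp: case_prod_unfold)
  show "(\<integral>(x, y, w). F (x, w) \<partial>Q) = (\<integral>v. F v \<partial>(\<mu> \<Otimes>\<^sub>M \<mu>))"
    by (subst (2) distr_Q_13[symmetric], subst integral_distr) (auto simp: case_prod_unfold)
qed

lemma Q_1:
  fixes F :: "real \<Rightarrow> real"
  assumes [measurable]: "F \<in> borel_measurable \<mu>"
  shows "integrable Q (\<lambda>(x, y, w). F x) \<longleftrightarrow> integrable \<mu> F"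
    and "(\<integral>(x, y, w). F x \<partial>Q) = (\<integral>x. F x \<partial>\<mu>)"
proof -
  have d: "distr Q \<mu> fst = \<mu>" by (rule P.distr_pair_fst)
  show "integrable Q (\<lambda>(x, y, w). F x) \<longleftrightarrow> integrable \<mu> F"
    by (subst (2) d[symmetric], subst integrable_distr_eq) (auto simp: case_prod_unfold)
  show "(\<integral>(x, y, w). F x \<partial>Q) = (\<integral>x. F x \<partial>\<mu>)"
    by (subst (2) d[symmetric], subst integral_distr) (auto simp: case_prod_unfold)
qed

text \<open>Jensen's inequality carries the exponential moment over to the projection.\<close>

lemma g_exp: "integrable \<mu> (\<lambda>x. exp (h * \<bar>g x\<bar>))"
proof (rule Bochner_Integration.integrable_bound)
  show "integrable \<mu> (\<lambda>x. \<integral>y. exp (h * \<bar>z (x, y)\<bar>) \<partial>\<mu>)"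
    using P.integrable_fst'[OF z_exp] by simp
  show "AE x in \<mu>. norm (exp (h * \<bar>g x\<bar>)) \<le> norm (\<integral>y. exp (h * \<bar>z (x, y)\<bar>) \<partial>\<mu>)"
    using P.AE_integrable_fst'[OF z_exp] AE_space
  proof eventually_elim
    fix x assume x[measurable]: "x \<in> space \<mu>" and e: "integrable \<mu> (\<lambda>y. exp (h * \<bar>z (x, y)\<bar>))"
    have [measurable]: "(\<lambda>y. z (x, y)) \<in> borel_measurable \<mu>" by measurable
    have i: "integrable \<mu> (\<lambda>y. z (x, y))"
      by (rule integrable_powers_of_exp_moment(1)[OF _ h_pos e]) measurable
    have "exp (h * \<bar>g x\<bar>) \<le> exp (expectation (\<lambda>y. h * \<bar>z (x, y)\<bar>))"
      using h_pos integral_abs_bound[of \<mu> "\<lambda>y. z (x, y)"] by (simp add: g_def)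
    also have "\<dots> \<le> expectation (\<lambda>y. exp (h * \<bar>z (x, y)\<bar>))"
      using i e by (intro jensens_inequality[where I = UNIV]) (auto intro: exp_convex)
    finally show "norm (exp (h * \<bar>g x\<bar>)) \<le> norm (\<integral>y. exp (h * \<bar>z (x, y)\<bar>) \<partial>\<mu>)" by simp
  qed
qed measurable

lemma g_mean: "expectation g = 0"
  using P.integral_fst'[of z] P.integrable_powers_of_exp_moment(1)[OF z_measurable_pair h_pos z_exp] z_mean
  by (simp add: g_def[abs_def])

lemma exp_abs_affine_comb_le:
  fixes a b d \<alpha> \<beta> \<gamma> t :: real
  assumes "t * (\<bar>\<alpha>\<bar> + \<bar>\<beta>\<bar> + \<bar>\<gamma>\<bar>) \<le> h" "t \<ge> 0"
  shows "exp (t * \<bar>\<alpha> * a + \<beta> * b + \<gamma> * d\<bar>) \<le> exp (h * \<bar>a\<bar>) + exp (h * \<bar>b\<bar>) + exp (h * \<bar>d\<bar>)"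
proof -
  define m where "m = max \<bar>a\<bar> (max \<bar>b\<bar> \<bar>d\<bar>)"
  have "\<bar>\<alpha> * a + \<beta> * b + \<gamma> * d\<bar> \<le> \<bar>\<alpha>\<bar> * \<bar>a\<bar> + \<bar>\<beta>\<bar> * \<bar>b\<bar> + \<bar>\<gamma>\<bar> * \<bar>d\<bar>"
    by (metis (no_types, opaque_lifting) abs_mult abs_triangle_ineq add_right_mono order_trans)
  also have "\<dots> \<le> \<bar>\<alpha>\<bar> * m + \<bar>\<beta>\<bar> * m + \<bar>\<gamma>\<bar> * m"
    by (intro add_mono mult_left_mono) (auto simp: m_def)
  finally have "\<bar>\<alpha> * a + \<beta> * b + \<gamma> * d\<bar> \<le> (\<bar>\<alpha>\<bar> + \<bar>\<beta>\<bar> + \<bar>\<gamma>\<bar>) * m"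
    by (simp add: distrib_right)
  from mult_left_mono[OF this assms(2)]
  have "t * \<bar>\<alpha> * a + \<beta> * b + \<gamma> * d\<bar> \<le> t * (\<bar>\<alpha>\<bar> + \<bar>\<beta>\<bar> + \<bar>\<gamma>\<bar>) * m"
    by (simp add: mult.assoc)
  also have "\<dots> \<le> h * m" using assms(1) by (intro mult_right_mono) (auto simp: m_def le_max_iff_disj)
  finally have "exp (t * \<bar>\<alpha> * a + \<beta> * b + \<gamma> * d\<bar>) \<le> exp (h * m)" by simp
  also have "\<dots> \<le> exp (h * \<bar>a\<bar>) + exp (h * \<bar>b\<bar>) + exp (h * \<bar>d\<bar>)"
    using exp_gt_zero[of "h * \<bar>a\<bar>"] exp_gt_zero[of "h * \<bar>b\<bar>"] exp_gt_zero[of "h * \<bar>d\<bar>"]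
    unfolding m_def max_def by (auto intro: less_imp_le add_increasing add_increasing2)
  finally show ?thesis .
qed

text \<open>The modulus of a linear combination is at most the largest modulus times the sum of the absolute
  coefficients, so a small enough exponential moment is bounded by the sum of the three given ones.\<close>

lemma comb_exp: "\<exists>t>0. integrable Q (\<lambda>v. exp (t * \<bar>comb \<alpha> \<beta> \<gamma> v\<bar>))"
proof -
  define t where "t = h / (\<bar>\<alpha>\<bar> + \<bar>\<beta>\<bar> + \<bar>\<gamma>\<bar> + 1)"
  have t: "t > 0" using h_pos by (auto simp: t_def intro!: divide_pos_pos)
  have th: "t * (\<bar>\<alpha>\<bar> + \<bar>\<beta>\<bar> + \<bar>\<gamma>\<bar>) \<le> h"
    using h_pos by (simp add: t_def field_simps)
  have "integrable Q (\<lambda>v. exp (t * \<bar>comb \<alpha> \<beta> \<gamma> v\<bar>))"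
  proof (rule Bochner_Integration.integrable_bound)
    show "integrable Q (\<lambda>v. (case v of (x, y, w) \<Rightarrow> exp (h * \<bar>z (x, y)\<bar>))
       + (case v of (x, y, w) \<Rightarrow> exp (h * \<bar>z (x, w)\<bar>)) + (case v of (x, y, w) \<Rightarrow> exp (h * \<bar>g x\<bar>)))"
      using Q_12(1)[of "\<lambda>v. exp (h * \<bar>z v\<bar>)"] Q_13(1)[of "\<lambda>v. exp (h * \<bar>z v\<bar>)"]
        Q_1(1)[of "\<lambda>x. exp (h * \<bar>g x\<bar>)"] z_exp g_exp
      by (intro Bochner_Integration.integrable_add) (auto simp: case_prod_unfold)
    show "AE v in Q. norm (exp (t * \<bar>comb \<alpha> \<beta> \<gamma> v\<bar>)) \<le> norm ((case v of (x, y, w) \<Rightarrow> exp (h * \<bar>z (x, y)\<bar>))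
       + (case v of (x, y, w) \<Rightarrow> exp (h * \<bar>z (x, w)\<bar>)) + (case v of (x, y, w) \<Rightarrow> exp (h * \<bar>g x\<bar>)))"
      using exp_abs_affine_comb_le[OF th] t by (intro AE_I2) (auto simp: comb_def)
  qed measurable
  with t show ?thesis by blast
qed

lemma comb_square_integrable: "integrable Q (comb \<alpha> \<beta> \<gamma>)" "integrable Q (\<lambda>v. (comb \<alpha> \<beta> \<gamma> v)\<^sup>2)"
  using comb_exp[of \<alpha> \<beta> \<gamma>] Q.integrable_powers_of_exp_moment[OF comb_measurable] by blast+

lemma integrable_mult_of_squares:
  fixes F G :: "'c \<Rightarrow> real"
  assumes [measurable]: "F \<in> borel_measurable N" "G \<in> borel_measurable N"
    and "integrable N (\<lambda>x. (F x)\<^sup>2)" "integrable N (\<lambda>x. (G x)\<^sup>2)"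
  shows "integrable N (\<lambda>x. F x * G x)"
proof (rule Bochner_Integration.integrable_bound)
  show "integrable N (\<lambda>x. (F x)\<^sup>2 + (G x)\<^sup>2)" using assms by simp
  have "\<bar>a * b\<bar> \<le> a\<^sup>2 + b\<^sup>2" for a b :: real
    using sum_squares_bound[of "\<bar>a\<bar>" "\<bar>b\<bar>"] abs_ge_zero[of "a * b"]
    unfolding abs_mult power2_abs mult.assoc by linarith
  then show "AE x in N. norm (F x * G x) \<le> norm ((F x)\<^sup>2 + (G x)\<^sup>2)" by simp
qed measurable

text \<open>Conditionally on the common argument, the two kernel values are independent with mean \<open>g x\<close>;
  hence every mixed moment reduces to the second moment of \<open>g\<close>.\<close>

lemma comb_covariances:
  shows "(\<integral>v. comb 1 0 0 v * comb 0 1 0 v \<partial>Q) = \<rho>"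
    and "(\<integral>v. comb 1 0 0 v * comb 0 0 1 v \<partial>Q) = \<rho>"
    and "(\<integral>v. comb 0 1 0 v * comb 0 0 1 v \<partial>Q) = \<rho>"
    and "(\<integral>v. (comb 1 0 0 v)\<^sup>2 \<partial>Q) = 1"
    and "(\<integral>v. (comb 0 1 0 v)\<^sup>2 \<partial>Q) = 1"
    and "(\<integral>v. (comb 0 0 1 v)\<^sup>2 \<partial>Q) = \<rho>"
proof -
  have int: "integrable Q (\<lambda>v. comb a b d v * comb a' b' d' v)" for a b d a' b' d'
    by (intro integrable_mult_of_squares comb_square_integrable) measurable
  have zg: "(\<integral>v. z v * g (fst v) \<partial>(\<mu> \<Otimes>\<^sub>M \<mu>)) = \<rho>"
  proof -
    have "integrable (\<mu> \<Otimes>\<^sub>M \<mu>) (\<lambda>v. z v * g (fst v))"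
      using int[of 1 0 0 0 0 1] Q_12(1)[of "\<lambda>v. z v * g (fst v)"] by (simp add: comb_def case_prod_unfold)
    from P.integral_fst'[OF this] show ?thesis by (simp add: \<rho>_def g_def power2_eq_square)
  qed
  show "(\<integral>v. comb 1 0 0 v * comb 0 0 1 v \<partial>Q) = \<rho>"
    using Q_12(2)[of "\<lambda>v. z v * g (fst v)"] zg by (simp add: comb_def case_prod_unfold)
  show "(\<integral>v. comb 0 1 0 v * comb 0 0 1 v \<partial>Q) = \<rho>"
    using Q_13(2)[of "\<lambda>v. z v * g (fst v)"] zg by (simp add: comb_def case_prod_unfold)
  show "(\<integral>v. (comb 1 0 0 v)\<^sup>2 \<partial>Q) = 1"
    using Q_12(2)[of "\<lambda>v. (z v)\<^sup>2"] z_var by (simp add: comb_def case_prod_unfold)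
  show "(\<integral>v. (comb 0 1 0 v)\<^sup>2 \<partial>Q) = 1"
    using Q_13(2)[of "\<lambda>v. (z v)\<^sup>2"] z_var by (simp add: comb_def case_prod_unfold)
  show "(\<integral>v. (comb 0 0 1 v)\<^sup>2 \<partial>Q) = \<rho>"
    using Q_1(2)[of "\<lambda>x. (g x)\<^sup>2"] by (simp add: comb_def case_prod_unfold \<rho>_def)
  have i: "integrable Q (\<lambda>v. z (fst v, fst (snd v)) * z (fst v, snd (snd v)))"
    using int[of 1 0 0 0 1 0] by (simp add: comb_def case_prod_unfold)
  have "(\<integral>v. comb 1 0 0 v * comb 0 1 0 v \<partial>Q) = (\<integral>x. \<integral>v. z (x, fst v) * z (x, snd v) \<partial>(\<mu> \<Otimes>\<^sub>M \<mu>) \<partial>\<mu>)"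
    using Q.integral_fst'[OF i] by (simp add: comb_def case_prod_unfold)
  also have "\<dots> = (\<integral>x. (g x)\<^sup>2 \<partial>\<mu>)"
  proof (rule integral_cong_AE)
    show "AE x in \<mu>. (\<integral>v. z (x, fst v) * z (x, snd v) \<partial>(\<mu> \<Otimes>\<^sub>M \<mu>)) = (g x)\<^sup>2"
      using Q.AE_integrable_fst'[OF i]
    proof eventually_elim
      fix x assume "integrable (\<mu> \<Otimes>\<^sub>M \<mu>) (\<lambda>v. z (fst (x, v), fst (snd (x, v))) * z (fst (x, v), snd (snd (x, v))))"
      then have "integrable (\<mu> \<Otimes>\<^sub>M \<mu>) (\<lambda>v. z (x, fst v) * z (x, snd v))" by simp
      from P.integral_fst'[OF this]
      show "(\<integral>v. z (x, fst v) * z (x, snd v) \<partial>(\<mu> \<Otimes>\<^sub>M \<mu>)) = (g x)\<^sup>2"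
        by (simp add: g_def power2_eq_square)
    qed
  qed measurable
  finally show "(\<integral>v. comb 1 0 0 v * comb 0 1 0 v \<partial>Q) = \<rho>" by (simp add: \<rho>_def)
qed

text \<open>The variance of \<open>comb \<alpha> \<beta> \<gamma>\<close>.\<close>

definition V :: "real \<Rightarrow> real \<Rightarrow> real \<Rightarrow> real" where
  "V \<alpha> \<beta> \<gamma> = \<alpha>\<^sup>2 + \<beta>\<^sup>2 + 2 * \<alpha> * \<beta> * \<rho> + (\<gamma>\<^sup>2 + 2 * \<alpha> * \<gamma> + 2 * \<beta> * \<gamma>) * \<rho>"

lemma comb_moments:
  shows "(\<integral>v. comb \<alpha> \<beta> \<gamma> v \<partial>Q) = 0" and "(\<integral>v. (comb \<alpha> \<beta> \<gamma> v)\<^sup>2 \<partial>Q) = V \<alpha> \<beta> \<gamma>"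
proof -
  have lin: "comb \<alpha> \<beta> \<gamma> v = \<alpha> * comb 1 0 0 v + \<beta> * comb 0 1 0 v + \<gamma> * comb 0 0 1 v" for v
    by (simp add: comb_def case_prod_unfold)
  note i = comb_square_integrable(1)
  have "(\<integral>v. comb 1 0 0 v \<partial>Q) = 0" "(\<integral>v. comb 0 1 0 v \<partial>Q) = 0" "(\<integral>v. comb 0 0 1 v \<partial>Q) = 0"
    using Q_12(2)[of z] Q_13(2)[of z] Q_1(2)[of g] z_mean g_mean
    by (simp_all add: comb_def case_prod_unfold)
  then show "(\<integral>v. comb \<alpha> \<beta> \<gamma> v \<partial>Q) = 0" unfolding lin using i by simp
  have int: "integrable Q (\<lambda>v. comb a b d v * comb a' b' d' v)" for a b d a' b' d'
    by (intro integrable_mult_of_squares comb_square_integrable) measurable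
  have "(comb \<alpha> \<beta> \<gamma> v)\<^sup>2 = \<alpha>\<^sup>2 * (comb 1 0 0 v)\<^sup>2 + \<beta>\<^sup>2 * (comb 0 1 0 v)\<^sup>2 + \<gamma>\<^sup>2 * (comb 0 0 1 v)\<^sup>2
     + 2 * \<alpha> * \<beta> * (comb 1 0 0 v * comb 0 1 0 v) + 2 * \<alpha> * \<gamma> * (comb 1 0 0 v * comb 0 0 1 v)
     + 2 * \<beta> * \<gamma> * (comb 0 1 0 v * comb 0 0 1 v)" for v
    unfolding lin by (simp add: power2_eq_square algebra_simps)
  then show "(\<integral>v. (comb \<alpha> \<beta> \<gamma> v)\<^sup>2 \<partial>Q) = V \<alpha> \<beta> \<gamma>"
    using int comb_square_integrable(2) by (simp add: comb_covariances V_def algebra_simps)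
qed

end

section \<open>Arrays of independent entries\<close>

text \<open>The predicate \<open>indep_var\<close> forces both variables to take values in the same type. Applying
  functions with different ranges to two independent restrictions of an array avoids this, and so
  gives the joint law of an entry and a pair of entries.\<close>

lemma (in prob_space) indep_var_distr_pair:
  assumes ind: "indep_var N1 A N2 B"
    and [measurable]: "Y1 \<in> measurable N1 T1" "Y2 \<in> measurable N2 T2"
  shows "distr M T1 (\<lambda>\<omega>. Y1 (A \<omega>)) \<Otimes>\<^sub>M distr M T2 (\<lambda>\<omega>. Y2 (B \<omega>))
    = distr M (T1 \<Otimes>\<^sub>M T2) (\<lambda>\<omega>. (Y1 (A \<omega>), Y2 (B \<omega>)))"
proof -
  have [measurable]: "A \<in> measurable M N1" "B \<in> measurable M N2"
    using ind indep_var_rv1 indep_var_rv2 by blast+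
  interpret B: prob_space "distr M N2 B" by (rule prob_space_distr) measurable
  interpret YB: prob_space "distr (distr M N2 B) T2 Y2" by (rule B.prob_space_distr) measurable
  have "distr M T1 (\<lambda>\<omega>. Y1 (A \<omega>)) \<Otimes>\<^sub>M distr M T2 (\<lambda>\<omega>. Y2 (B \<omega>))
      = distr (distr M N1 A) T1 Y1 \<Otimes>\<^sub>M distr (distr M N2 B) T2 Y2"
    by (simp add: distr_distr comp_def)
  also have "\<dots> = distr (distr M N1 A \<Otimes>\<^sub>M distr M N2 B) (T1 \<Otimes>\<^sub>M T2) (\<lambda>(x, y). (Y1 x, Y2 y))"
    by (intro pair_measure_distr YB.sigma_finite_measure_axioms) measurable
  also have "distr M N1 A \<Otimes>\<^sub>M distr M N2 B = distr M (N1 \<Otimes>\<^sub>M N2) (\<lambda>\<omega>. (A \<omega>, B \<omega>))"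
    using ind by (simp add: indep_var_distribution_eq)
  finally show ?thesis by (simp add: distr_distr comp_def)
qed

lemma (in prob_space) indep_vars_rv: "indep_vars N Y I \<Longrightarrow> k \<in> I \<Longrightarrow> Y k \<in> measurable M (N k)"
  unfolding indep_vars_def by blast

lemma (in prob_space) iid_array_measurable:
  assumes "iid_array M X" "1 \<le> i" "1 \<le> t" shows "X i t \<in> borel_measurable M"
proof -
  have "indep_vars (\<lambda>_. borel) (\<lambda>(i, t). X i t) ({1..} \<times> {1..})"
    using assms(1) unfolding iid_array_def by (rule conjunct1)
  from indep_vars_rv[OF this, of "(i, t)"] show ?thesis using assms(2,3) by simp
qed

lemma (in prob_space) iid_array_pair_distr:
  assumes "iid_array M X"
  shows "distr M (borel \<Otimes>\<^sub>M borel) (\<lambda>\<omega>. (X 1 1 \<omega>, X 2 1 \<omega>))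
    = distr M borel (X 1 1) \<Otimes>\<^sub>M distr M borel (X 1 1)"
proof -
  let ?R = "\<lambda>A \<omega>. \<lambda>i\<in>A. (case i of (i, t) \<Rightarrow> X i t) \<omega>"
  have ind: "indep_vars (\<lambda>_. borel) (\<lambda>(i, t). X i t) ({1..} \<times> {1..})"
    and id: "\<forall>i\<ge>1. \<forall>t\<ge>1. distr M borel (X i t) = distr M borel (X 1 1)"
    using assms unfolding iid_array_def by blast+
  have eq: "distr M borel (X 2 1) = distr M borel (X 1 1)"
    using id[rule_format, OF one_le_numeral order_refl] .
  have "indep_var (PiM {(1, 1)} (\<lambda>_. borel)) (?R {(1, 1)}) (PiM {(2, 1)} (\<lambda>_. borel)) (?R {(2, 1)})"
    by (intro indep_var_restrict[OF ind]) auto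
  from indep_var_distr_pair[OF this, of "\<lambda>v. v (1, 1)" borel "\<lambda>v. v (2, 1)" borel]
  show ?thesis using eq by simp
qed

text \<open>An array of independent entries with law \<open>\<mu>\<close>, together with a standardised kernel for that law.\<close>

locale iid_kernel_array = prob_space M + K: standardised_kernel \<mu> z h
  for M :: "'a measure" and \<mu> :: "real measure" and z h +
  fixes X :: "nat \<Rightarrow> nat \<Rightarrow> 'a \<Rightarrow> real"
  assumes iid: "iid_array M X" and \<mu>: "\<mu> = distr M borel (X 1 1)"
begin

lemma entries_indep: "indep_vars (\<lambda>_. borel) (\<lambda>(i, t). X i t) ({1..} \<times> {1..})"
  using iid by (simp add: iid_array_def)

lemma entry_measurable[measurable (raw)]: "1 \<le> i \<Longrightarrow> 1 \<le> t \<Longrightarrow> X i t \<in> borel_measurable M"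
  by (rule iid_array_measurable[OF iid])

lemma entry_distr: "1 \<le> i \<Longrightarrow> 1 \<le> t \<Longrightarrow> distr M borel (X i t) = \<mu>"
  using iid unfolding iid_array_def \<mu> by blast

lemma sets_Q: "sets K.Q = sets (borel \<Otimes>\<^sub>M (borel \<Otimes>\<^sub>M borel))"
  by (intro sets_pair_measure_cong) simp_all

lemma triple_measurable:
  assumes "1 \<le> a" "1 \<le> b" "1 \<le> c" "1 \<le> l"
  shows "(\<lambda>\<omega>. (X a l \<omega>, X b l \<omega>, X c l \<omega>)) \<in> measurable M K.Q"
  unfolding measurable_cong_sets[OF refl sets_Q] using assms by (intro measurable_Pair) simp_all

lemma triple_distr:
  assumes pos: "1 \<le> a" "1 \<le> b" "1 \<le> c" "1 \<le> l" and ne: "a \<noteq> b" "a \<noteq> c" "b \<noteq> c"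
  shows "distr M K.Q (\<lambda>\<omega>. (X a l \<omega>, X b l \<omega>, X c l \<omega>)) = K.Q"
proof -
  let ?R = "\<lambda>A \<omega>. \<lambda>i\<in>A. (case i of (i, t) \<Rightarrow> X i t) \<omega>"
  have "indep_var (PiM {(b, l)} (\<lambda>_. borel)) (?R {(b, l)}) (PiM {(c, l)} (\<lambda>_. borel)) (?R {(c, l)})"
    using pos ne by (intro indep_var_restrict[OF entries_indep]) auto
  from indep_var_distr_pair[OF this, of "\<lambda>v. v (b, l)" borel "\<lambda>v. v (c, l)" borel]
  have bc: "distr M borel (X b l) \<Otimes>\<^sub>M distr M borel (X c l)
      = distr M (borel \<Otimes>\<^sub>M borel) (\<lambda>\<omega>. (X b l \<omega>, X c l \<omega>))"
    by simp
  have "indep_var (PiM {(a, l)} (\<lambda>_. borel)) (?R {(a, l)})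
      (PiM {(b, l), (c, l)} (\<lambda>_. borel)) (?R {(b, l), (c, l)})"
    using pos ne by (intro indep_var_restrict[OF entries_indep]) auto
  from indep_var_distr_pair[OF this, of "\<lambda>v. v (a, l)" borel "\<lambda>v. (v (b, l), v (c, l))" "borel \<Otimes>\<^sub>M borel"]
  have abc: "distr M borel (X a l) \<Otimes>\<^sub>M distr M (borel \<Otimes>\<^sub>M borel) (\<lambda>\<omega>. (X b l \<omega>, X c l \<omega>))
      = distr M (borel \<Otimes>\<^sub>M (borel \<Otimes>\<^sub>M borel)) (\<lambda>\<omega>. (X a l \<omega>, X b l \<omega>, X c l \<omega>))"
    by simp
  have "K.Q = distr M borel (X a l) \<Otimes>\<^sub>M (distr M borel (X b l) \<Otimes>\<^sub>M distr M borel (X c l))"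
    using pos by (simp add: entry_distr)
  also have "\<dots> = distr M (borel \<Otimes>\<^sub>M (borel \<Otimes>\<^sub>M borel)) (\<lambda>\<omega>. (X a l \<omega>, X b l \<omega>, X c l \<omega>))"
    by (simp only: bc abc)
  also have "\<dots> = distr M K.Q (\<lambda>\<omega>. (X a l \<omega>, X b l \<omega>, X c l \<omega>))"
    by (intro distr_cong sets_pair_measure_cong) simp_all
  finally show ?thesis by simp
qed

lemma triples_indep:
  assumes pos: "1 \<le> a" "1 \<le> b" "1 \<le> c" and H[measurable]: "H \<in> borel_measurable K.Q"
  shows "indep_vars (\<lambda>_. borel) (\<lambda>l \<omega>. H (X a l \<omega>, X b l \<omega>, X c l \<omega>)) {1..n}"
proof -
  let ?K = "\<lambda>l. {(a, l), (b, l), (c, l)}"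
  have "indep_vars (\<lambda>l. PiM (?K l) (\<lambda>_. borel)) (\<lambda>l \<omega>. \<lambda>i\<in>?K l. (case i of (i, t) \<Rightarrow> X i t) \<omega>) {1..n}"
    using pos by (intro indep_vars_restrict[OF entries_indep]) (auto simp: disjoint_family_on_def)
  then have "indep_vars (\<lambda>_. borel)
     (\<lambda>l \<omega>. (\<lambda>v. H (v (a, l), v (b, l), v (c, l))) (\<lambda>i\<in>?K l. (case i of (i, t) \<Rightarrow> X i t) \<omega>)) {1..n}"
  proof (rule indep_vars_compose2)
    fix l
    have "(\<lambda>v. (v (a, l), v (b, l), v (c, l))) \<in> measurable (PiM (?K l) (\<lambda>_. borel)) K.Q"
      unfolding measurable_cong_sets[OF refl sets_Q] by measurable
    then show "(\<lambda>v. H (v (a, l), v (b, l), v (c, l))) \<in> borel_measurable (PiM (?K l) (\<lambda>_. borel))"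
      by measurable
  qed
  then show ?thesis by simp
qed

text \<open>With \<open>s = sqrt (L / n)\<close>, these are \<open>sqrt L\<close> times the statistic of the pair \<open>(i, j)\<close> and its
  projection onto row \<open>i\<close>. In this normalisation every threshold is a multiple of \<open>L\<close>.\<close>

definition S :: "real \<Rightarrow> nat \<Rightarrow> nat \<Rightarrow> nat \<Rightarrow> 'a \<Rightarrow> real" where
  "S s n i j \<omega> = s * (\<Sum>l = 1..n. z (X i l \<omega>, X j l \<omega>))"

definition \<Gamma> :: "real \<Rightarrow> nat \<Rightarrow> nat \<Rightarrow> 'a \<Rightarrow> real" where
  "\<Gamma> s n i \<omega> = s * (\<Sum>l = 1..n. K.g (X i l \<omega>))"

lemma S_sym: "S s n i j = S s n j i"
  unfolding S_def by (subst K.z_sym) simp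

lemma z_entries_measurable[measurable (raw)]:
  assumes "1 \<le> i" "1 \<le> j" "1 \<le> l" shows "(\<lambda>\<omega>. z (X i l \<omega>, X j l \<omega>)) \<in> borel_measurable M"
proof -
  have "(\<lambda>\<omega>. (X i l \<omega>, X j l \<omega>)) \<in> measurable M (borel \<Otimes>\<^sub>M borel)"
    using assms by (intro measurable_Pair) simp_all
  then show ?thesis unfolding borel_prod by measurable
qed

lemma S_measurable[measurable (raw)]: "1 \<le> i \<Longrightarrow> 1 \<le> j \<Longrightarrow> S s n i j \<in> borel_measurable M"
  unfolding S_def by (intro borel_measurable_times borel_measurable_sum z_entries_measurable) auto

lemma \<Gamma>_measurable[measurable (raw)]: "1 \<le> i \<Longrightarrow> \<Gamma> s n i \<in> borel_measurable M"
  unfolding \<Gamma>_def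
  by (intro borel_measurable_times borel_measurable_sum measurable_compose[OF entry_measurable K.g_measurable]) auto

text \<open>The columns of the array are independent and identically distributed, so that the exponential
  moment is an \<open>n\<close>-th power. Its base is the same for all distinct rows \<open>a, b, c\<close>,
  which makes the later estimates uniform over the rows.\<close>

lemma exp_moment_power:
  fixes n :: nat
  assumes pos: "1 \<le> a" "1 \<le> b" "1 \<le> c" and ne: "a \<noteq> b" "a \<noteq> c" "b \<noteq> c"
    and int: "integrable K.Q (\<lambda>v. exp (s * K.comb \<alpha> \<beta> \<gamma> v))"
  defines "W \<equiv> \<lambda>\<omega>. \<alpha> * S s n a b \<omega> + \<beta> * S s n a c \<omega> + \<gamma> * \<Gamma> s n a \<omega>"
  shows "integrable M (\<lambda>\<omega>. exp (W \<omega>))"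
    and "expectation (\<lambda>\<omega>. exp (W \<omega>)) = (\<integral>v. exp (s * K.comb \<alpha> \<beta> \<gamma> v) \<partial>K.Q) ^ n"
proof -
  let ?H = "\<lambda>v. exp (s * K.comb \<alpha> \<beta> \<gamma> v)"
  let ?Y = "\<lambda>l \<omega>. ?H (X a l \<omega>, X b l \<omega>, X c l \<omega>)"
  have H[measurable]: "?H \<in> borel_measurable K.Q" by measurable
  have prod: "exp (W \<omega>) = (\<Prod>l\<in>{1..n}. ?Y l \<omega>)" for \<omega>
    by (simp add: W_def S_def \<Gamma>_def K.comb_def exp_sum[symmetric] sum.distrib sum_distrib_left algebra_simps)
  have Y: "integrable M (?Y l)" "expectation (?Y l) = (\<integral>v. ?H v \<partial>K.Q)" if "l \<in> {1..n}" for l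
  proof -
    have l: "1 \<le> l" using that by simp
    note d = triple_distr[OF pos l ne] and m = triple_measurable[OF pos l]
    show "integrable M (?Y l)"
      using int integrable_distr[OF m, of ?H] by (simp add: d)
    show "expectation (?Y l) = (\<integral>v. ?H v \<partial>K.Q)"
      using integral_distr[OF m H] by (simp add: d)
  qed
  note ind = triples_indep[OF pos H, of n]
  show "integrable M (\<lambda>\<omega>. exp (W \<omega>))" unfolding prod
    using Y by (intro indep_vars_integrable ind) auto
  show "expectation (\<lambda>\<omega>. exp (W \<omega>)) = (\<integral>v. ?H v \<partial>K.Q) ^ n" unfolding prod
    using Y by (subst indep_vars_lebesgue_integral[OF _ ind]) auto
qed

section \<open>Exponential estimates at the scale of the logarithm\<close>

abbreviation scale :: "(nat \<Rightarrow> real) \<Rightarrow> nat \<Rightarrow> real" where "scale L n \<equiv> sqrt (L n / real n)"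

text \<open>The \<open>n\<close>-th power of the moment generating function at \<open>s = sqrt (L / n)\<close> is the exponential of
  \<open>n s\<^sup>2 = L\<close> times the quotient of the cumulant generating function and \<open>s\<^sup>2\<close>. Since \<open>s\<close> tends
  to zero, that quotient tends to half the variance.\<close>

lemma exp_moment_growth:
  fixes L :: "nat \<Rightarrow> real"
  assumes L: "filterlim L at_top sequentially" and Ln: "(\<lambda>n. L n / n) \<longlonglongrightarrow> 0" and e: "\<epsilon> > 0"
  shows "\<forall>\<^sub>F n in sequentially. \<forall>a b c. 1 \<le> a \<longrightarrow> 1 \<le> b \<longrightarrow> 1 \<le> c \<longrightarrow> a \<noteq> b \<longrightarrow> a \<noteq> c \<longrightarrow> b \<noteq> c \<longrightarrow>
    (let W = (\<lambda>\<omega>. exp (\<alpha> * S (scale L n) n a b \<omega> + \<beta> * S (scale L n) n a c \<omega>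
                + \<gamma> * \<Gamma> (scale L n) n a \<omega>))
     in integrable M W \<and> exp ((K.V \<alpha> \<beta> \<gamma> / 2 - \<epsilon>) * L n) \<le> expectation W
          \<and> expectation W \<le> exp ((K.V \<alpha> \<beta> \<gamma> / 2 + \<epsilon>) * L n))"
proof -
  obtain t where t: "t > 0" "integrable K.Q (\<lambda>v. exp (t * \<bar>K.comb \<alpha> \<beta> \<gamma> v\<bar>))"
    using K.comb_exp by blast
  define \<phi> where "\<phi> s = (\<integral>v. exp (s * K.comb \<alpha> \<beta> \<gamma> v) \<partial>K.Q)" for s
  define s where "s n = sqrt (L n / real n)" for n
  have lim: "((\<lambda>s. ln (\<phi> s) / s\<^sup>2) \<longlongrightarrow> K.V \<alpha> \<beta> \<gamma> / 2) (at 0)"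
    using K.Q.cumulant_generating_function_second_order[OF K.comb_measurable t K.comb_moments(1)]
    by (simp add: \<phi>_def K.comb_moments)
  have Lpos: "\<forall>\<^sub>F n in sequentially. L n > 0" using L by (simp add: filterlim_at_top_dense)
  have "s \<longlonglongrightarrow> sqrt 0" unfolding s_def[abs_def] by (intro tendsto_intros Ln)
  then have s0: "s \<longlonglongrightarrow> 0" by simp
  have "\<forall>\<^sub>F n in sequentially. s n \<noteq> 0"
    using Lpos eventually_gt_at_top[of 0] by eventually_elim (simp add: s_def)
  then have s: "filterlim s (at 0) sequentially" using s0 by (simp add: filterlim_at)
  have l: "(\<lambda>n. ln (\<phi> (s n)) / (s n)\<^sup>2) \<longlonglongrightarrow> K.V \<alpha> \<beta> \<gamma> / 2"
    by (rule filterlim_compose[OF lim s])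
  have st: "\<forall>\<^sub>F n in sequentially. \<bar>s n\<bar> < t"
    using order_tendstoD(2)[OF tendsto_rabs_zero[OF s0] t(1)] .
  have lo: "\<forall>\<^sub>F n in sequentially. K.V \<alpha> \<beta> \<gamma> / 2 - \<epsilon> < ln (\<phi> (s n)) / (s n)\<^sup>2"
    and hi: "\<forall>\<^sub>F n in sequentially. ln (\<phi> (s n)) / (s n)\<^sup>2 < K.V \<alpha> \<beta> \<gamma> / 2 + \<epsilon>"
    using e by (auto intro!: order_tendstoD[OF l])
  show ?thesis
    using lo hi st Lpos eventually_gt_at_top[of 0]
  proof eventually_elim
    case (elim n)
    have sn: "(s n)\<^sup>2 * n = L n" using elim by (simp add: s_def)
    have s2: "(s n)\<^sup>2 > 0" using elim by (simp add: s_def)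
    note m = K.Q.integrable_powers_of_exp_moment[OF K.comb_measurable t]
    have int: "integrable K.Q (\<lambda>v. exp (s n * K.comb \<alpha> \<beta> \<gamma> v))" using elim by (intro m(3)) simp
    have \<phi>1: "1 \<le> \<phi> (s n)" unfolding \<phi>_def
      by (intro K.Q.exp_moment_ge_one m(1) int K.comb_moments)
    have pw: "\<phi> (s n) ^ n = exp (ln (\<phi> (s n)) / (s n)\<^sup>2 * L n)"
    proof -
      have "\<phi> (s n) ^ n = exp (real n * ln (\<phi> (s n)))" using \<phi>1 by (simp add: exp_of_nat_mult)
      also have "real n * ln (\<phi> (s n)) = ln (\<phi> (s n)) / (s n)\<^sup>2 * L n"
        using s2 by (simp add: sn[symmetric])
      finally show ?thesis .
    qed
    have b: "exp ((K.V \<alpha> \<beta> \<gamma> / 2 - \<epsilon>) * L n) \<le> \<phi> (s n) ^ n" "\<phi> (s n) ^ n \<le> exp ((K.V \<alpha> \<beta> \<gamma> / 2 + \<epsilon>) * L n)"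
      unfolding pw using elim by (auto intro!: mult_right_mono simp del: times_divide_eq_left)
    show ?case
      using exp_moment_power[OF _ _ _ _ _ _ int, where n = n] b
      unfolding Let_def s_def[symmetric] \<phi>_def by auto
  qed
qed

text \<open>The case of two rows. The third row has coefficient zero; \<open>i + j\<close> is always
  admissible because it differs from \<open>i\<close> and \<open>j\<close>.\<close>

lemma exp_moment_bounds_pair:
  fixes L :: "nat \<Rightarrow> real"
  assumes L: "filterlim L at_top sequentially" and Ln: "(\<lambda>n. L n / n) \<longlonglongrightarrow> 0" and e: "\<epsilon> > 0"
  shows "\<forall>\<^sub>F n in sequentially. \<forall>i j. 1 \<le> i \<longrightarrow> 1 \<le> j \<longrightarrow> i \<noteq> j \<longrightarrow>
    (let W = (\<lambda>\<omega>. exp (\<alpha> * S (scale L n) n i j \<omega> + \<gamma> * \<Gamma> (scale L n) n i \<omega>))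
     in integrable M W \<and> exp ((K.V \<alpha> 0 \<gamma> / 2 - \<epsilon>) * L n) \<le> expectation W
          \<and> expectation W \<le> exp ((K.V \<alpha> 0 \<gamma> / 2 + \<epsilon>) * L n))"
  using exp_moment_growth[OF L Ln e, of \<alpha> 0 \<gamma>]
proof eventually_elim
  case (elim n)
  show ?case
  proof (intro allI impI)
    fix i j :: nat assume ij: "1 \<le> i" "1 \<le> j" "i \<noteq> j"
    then have "1 \<le> i + j" "i \<noteq> i + j" "j \<noteq> i + j" by auto
    with elim[rule_format, of i j "i + j"] ij
    show "let W = (\<lambda>\<omega>. exp (\<alpha> * S (scale L n) n i j \<omega> + \<gamma> * \<Gamma> (scale L n) n i \<omega>))
     in integrable M W \<and> exp ((K.V \<alpha> 0 \<gamma> / 2 - \<epsilon>) * L n) \<le> expectation W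
          \<and> expectation W \<le> exp ((K.V \<alpha> 0 \<gamma> / 2 + \<epsilon>) * L n)" by simp
  qed
qed

section \<open>The upper bound for the maximum\<close>

text \<open>The Chernoff parameter 2 is the optimal one for a standard Gaussian tail at the
  threshold 2, since the exponent \<open>t\<^sup>2 / 2 - 2 t\<close> is smallest at \<open>t = 2\<close>.\<close>

lemma pair_upper_tail:
  fixes L :: "nat \<Rightarrow> real"
  assumes L: "filterlim L at_top sequentially" and Ln: "(\<lambda>n. L n / n) \<longlonglongrightarrow> 0" and d: "\<delta> > 0"
  shows "\<forall>\<^sub>F n in sequentially. \<forall>i j. 1 \<le> i \<longrightarrow> 1 \<le> j \<longrightarrow> i \<noteq> j \<longrightarrow>
     prob {\<omega>\<in>space M. (2 + \<delta>) * L n < S (scale L n) n i j \<omega>} \<le> exp (- (2 + \<delta>) * L n)"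
  using exp_moment_bounds_pair[OF L Ln d, of 2 0]
proof eventually_elim
  case (elim n)
  show ?case
  proof (intro allI impI)
    fix i j :: nat assume ij: "1 \<le> i" "1 \<le> j" "i \<noteq> j"
    note [measurable] = S_measurable[OF ij(1,2)]
    let ?W = "\<lambda>\<omega>. 2 * S (scale L n) n i j \<omega>"
    have W: "integrable M (\<lambda>\<omega>. exp (?W \<omega>))" "expectation (\<lambda>\<omega>. exp (?W \<omega>)) \<le> exp ((2 + \<delta>) * L n)"
      using elim[rule_format, OF ij] by (simp_all add: Let_def K.V_def)
    have "prob {\<omega>\<in>space M. (2 + \<delta>) * L n < S (scale L n) n i j \<omega>}
        \<le> exp (- (2 * ((2 + \<delta>) * L n))) * expectation (\<lambda>\<omega>. exp (?W \<omega>))"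
      by (intro chernoff_bound[OF W(1)]) auto
    also have "\<dots> \<le> exp (- (2 * ((2 + \<delta>) * L n))) * exp ((2 + \<delta>) * L n)"
      using W(2) by (intro mult_left_mono) auto
    also have "\<dots> = exp (- (2 + \<delta>) * L n)"
      unfolding exp_add[symmetric] by (simp add: algebra_simps)
    finally show "prob {\<omega>\<in>space M. (2 + \<delta>) * L n < S (scale L n) n i j \<omega>} \<le> exp (- (2 + \<delta>) * L n)" .
  qed
qed

lemma exp_neg_tendsto_0:
  fixes L :: "nat \<Rightarrow> real"
  assumes "filterlim L at_top sequentially" "k > 0" shows "(\<lambda>n. exp (- k * L n)) \<longlonglongrightarrow> 0"
proof -
  have "((\<lambda>x. exp (- k * x)) \<longlongrightarrow> 0) at_top" using assms(2) by real_asymp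
  then show ?thesis using filterlim_compose assms(1) by blast
qed

text \<open>The union bound over at most \<open>exp (2 * L n)\<close> pairs.\<close>

lemma max_upper:
  fixes p :: "nat \<Rightarrow> nat"
  defines "L \<equiv> \<lambda>n. ln (real (p n))"
  assumes L: "filterlim L at_top sequentially" and Ln: "(\<lambda>n. L n / n) \<longlonglongrightarrow> 0" and d: "\<delta> > 0"
  shows "(\<lambda>n. prob (\<Union>(i, j)\<in>{(i, j). 1 \<le> i \<and> i < j \<and> j \<le> p n}.
            {\<omega>\<in>space M. (2 + \<delta>) * L n < S (scale L n) n i j \<omega>})) \<longlonglongrightarrow> 0"
proof (rule tendsto_sandwich[OF _ _ tendsto_const exp_neg_tendsto_0[OF L d]])
  have "\<forall>\<^sub>F n in sequentially. L n > 0" using L by (simp add: filterlim_at_top_dense)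
  then show "\<forall>\<^sub>F n in sequentially. prob (\<Union>(i, j)\<in>{(i, j). 1 \<le> i \<and> i < j \<and> j \<le> p n}.
            {\<omega>\<in>space M. (2 + \<delta>) * L n < S (scale L n) n i j \<omega>}) \<le> exp (- \<delta> * L n)"
    using pair_upper_tail[OF L Ln d]
  proof eventually_elim
    case (elim n)
    let ?I = "{(i, j). 1 \<le> i \<and> i < j \<and> j \<le> p n}"
    let ?A = "\<lambda>(i, j). {\<omega>\<in>space M. (2 + \<delta>) * L n < S (scale L n) n i j \<omega>}"
    have pn: "real (p n) = exp (L n)" using elim(1) by (cases "p n = 0") (auto simp: L_def)
    have sub: "?I \<subseteq> {1..p n} \<times> {1..p n}" by auto
    then have fin: "finite ?I" by (rule finite_subset) simp
    have "card ?I \<le> card ({1..p n} \<times> {1..p n})" by (intro card_mono sub) simp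
    then have "card ?I \<le> p n * p n" by simp
    then have "real (card ?I) \<le> real (p n * p n)" by (simp only: of_nat_le_iff)
    then have card: "real (card ?I) \<le> exp (2 * L n)" by (simp add: pn mult_exp_exp)
    have "prob (\<Union>e\<in>?I. ?A e) \<le> (\<Sum>e\<in>?I. prob (?A e))"
    proof (rule finite_measure_subadditive_finite[OF fin])
      have "?A e \<in> events" if "e \<in> ?I" for e
      proof -
        obtain i j where e: "e = (i, j)" by (cases e)
        have [measurable]: "S (scale L n) n i j \<in> borel_measurable M" using that e by (intro S_measurable) auto
        show ?thesis unfolding e by simp
      qed
      then show "?A ` ?I \<subseteq> events" by blast
    qed
    also have "\<dots> \<le> (\<Sum>e\<in>?I. exp (- (2 + \<delta>) * L n))"
      using elim(2) by (intro sum_mono) auto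
    also have "\<dots> = real (card ?I) * exp (- (2 + \<delta>) * L n)" by simp
    also have "\<dots> \<le> exp (2 * L n) * exp (- (2 + \<delta>) * L n)"
      using card by (intro mult_right_mono) auto
    also have "\<dots> = exp (- \<delta> * L n)" by (simp add: mult_exp_exp algebra_simps)
    finally show ?case .
  qed
qed simp

section \<open>The lower bound for the maximum\<close>

text \<open>The truncated event that is counted. The bounds \<open>x\<close> and \<open>u\<close> confine the statistic, and \<open>a\<close> bounds
  the projections onto both rows. The upper bound \<open>u\<close> turns a lower estimate of
  \<open>E exp (\<theta> * S s n i j)\<close> on the event into one of its probability.\<close>

definition good :: "real \<Rightarrow> nat \<Rightarrow> real \<Rightarrow> real \<Rightarrow> real \<Rightarrow> nat \<Rightarrow> nat \<Rightarrow> 'a set" where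
  "good s n x u a i j = {\<omega>\<in>space M. x \<le> S s n i j \<omega> \<and> S s n i j \<omega> \<le> u \<and> \<Gamma> s n i \<omega> \<le> a \<and> \<Gamma> s n j \<omega> \<le> a}"

lemma good_measurable[measurable]: "1 \<le> i \<Longrightarrow> 1 \<le> j \<Longrightarrow> good s n x u a i j \<in> events"
  unfolding good_def by measurable

lemma good_sym: "good s n x u a i j = good s n x u a j i"
  unfolding good_def S_sym[of s n i j] by auto

text \<open>The event of the pair \<open>(i, j)\<close> is determined by the entries in the rows \<open>i\<close> and \<open>j\<close>.\<close>

lemma good_indep:
  assumes pos: "1 \<le> i" "1 \<le> j" "1 \<le> i'" "1 \<le> j'" and disj: "{i, j} \<inter> {i', j'} = {}"
  shows "prob (good s n x u a i j \<inter> good s n x u a i' j') = prob (good s n x u a i j) * prob (good s n x u a i' j')"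
proof -
  let ?R = "\<lambda>A \<omega>. \<lambda>i\<in>A. (case i of (i, t) \<Rightarrow> X i t) \<omega>"
  define rows where "rows i j = {i, j} \<times> {1::nat..}" for i j :: nat
  define E where "E i j = {v \<in> space (PiM (rows i j) (\<lambda>_. borel)).
     x \<le> s * (\<Sum>l = 1..n. z (v (i, l), v (j, l))) \<and> s * (\<Sum>l = 1..n. z (v (i, l), v (j, l))) \<le> u
     \<and> s * (\<Sum>l = 1..n. K.g (v (i, l))) \<le> a \<and> s * (\<Sum>l = 1..n. K.g (v (j, l))) \<le> a}" for i j
  have E: "E i j \<in> sets (PiM (rows i j) (\<lambda>_. borel))" for i j
  proof -
    have c: "(\<lambda>v. v (k, l)) \<in> borel_measurable (PiM (rows i j) (\<lambda>_. borel))" if "k \<in> {i, j}" "1 \<le> l" for k l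
      using that by (intro measurable_component_singleton) (auto simp: rows_def)
    have "(\<lambda>v. (v (i, l), v (j, l))) \<in> measurable (PiM (rows i j) (\<lambda>_. borel)) (borel \<Otimes>\<^sub>M borel)" if "1 \<le> l" for l
      using that by (intro measurable_Pair c) auto
    then have "(\<lambda>v. z (v (i, l), v (j, l))) \<in> borel_measurable (PiM (rows i j) (\<lambda>_. borel))" if "1 \<le> l" for l
      using that unfolding borel_prod by measurable
    then have [measurable]: "(\<lambda>v. \<Sum>l = 1..n. z (v (i, l), v (j, l))) \<in> borel_measurable (PiM (rows i j) (\<lambda>_. borel))"
      by (intro borel_measurable_sum) auto
    have G: "(\<lambda>v. \<Sum>l = 1..n. K.g (v (k, l))) \<in> borel_measurable (PiM (rows i j) (\<lambda>_. borel))"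
      if "k \<in> {i, j}" for k
      using that by (intro borel_measurable_sum measurable_compose[OF c K.g_measurable]) auto
    have [measurable]: "(\<lambda>v. \<Sum>l = 1..n. K.g (v (i, l))) \<in> borel_measurable (PiM (rows i j) (\<lambda>_. borel))"
      "(\<lambda>v. \<Sum>l = 1..n. K.g (v (j, l))) \<in> borel_measurable (PiM (rows i j) (\<lambda>_. borel))"
      by (intro G; simp)+
    show ?thesis unfolding E_def by measurable
  qed
  have pre: "?R (rows i j) -` E i j \<inter> space M = good s n x u a i j" for i j
  proof -
    have "(\<Sum>l = 1..n. z (?R (rows i j) \<omega> (i, l), ?R (rows i j) \<omega> (j, l))) = (\<Sum>l = 1..n. z (X i l \<omega>, X j l \<omega>))"
      "(\<Sum>l = 1..n. K.g (?R (rows i j) \<omega> (i, l))) = (\<Sum>l = 1..n. K.g (X i l \<omega>))"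
      "(\<Sum>l = 1..n. K.g (?R (rows i j) \<omega> (j, l))) = (\<Sum>l = 1..n. K.g (X j l \<omega>))" for \<omega>
      by (intro sum.cong refl; simp add: rows_def)+
    then show ?thesis by (auto simp: E_def good_def S_def \<Gamma>_def space_PiM)
  qed
  have "indep_var (PiM (rows i j) (\<lambda>_. borel)) (?R (rows i j)) (PiM (rows i' j') (\<lambda>_. borel)) (?R (rows i' j'))"
    using pos disj by (intro indep_var_restrict[OF entries_indep]) (auto simp: rows_def)
  from indep_varD[OF this E[of i j] E[of i' j']]
  have "prob ((\<lambda>\<omega>. (?R (rows i j) \<omega>, ?R (rows i' j') \<omega>)) -` (E i j \<times> E i' j') \<inter> space M)
     = prob (good s n x u a i j) * prob (good s n x u a i' j')" by (simp add: pre)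
  also have "(\<lambda>\<omega>. (?R (rows i j) \<omega>, ?R (rows i' j') \<omega>)) -` (E i j \<times> E i' j') \<inter> space M
     = (?R (rows i j) -` E i j \<inter> space M) \<inter> (?R (rows i' j') -` E i' j' \<inter> space M)" by auto
  finally show ?thesis by (simp only: pre)
qed

abbreviation good_at where
  "good_at L \<theta> \<delta> n \<equiv> good (scale L n) n ((\<theta> - \<delta>) * L n) ((\<theta> + \<delta>) * L n) ((K.\<rho> * \<theta> + \<delta>) * L n)"

text \<open>A change of measure written with exponential moments only. Under the weight \<open>exp (\<theta> * T)\<close> the
  statistic \<open>T\<close> concentrates at \<open>\<theta> * L\<close> and the two projections concentrate at
  \<open>\<rho> * \<theta> * L\<close>. Hence each of the four ways to leave the event carries an exponentially smaller
  part of the total weight \<open>exp (\<theta>\<^sup>2 / 2 * L)\<close>, as a further tilt by \<open>\<delta>\<close> shows. The remaining weight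
  sits on the event, where the weight function is at most \<open>exp (\<theta> * u)\<close>.\<close>

lemma good_prob_lower:
  fixes L :: "nat \<Rightarrow> real"
  assumes L: "filterlim L at_top sequentially" and Ln: "(\<lambda>n. L n / n) \<longlonglongrightarrow> 0"
    and d: "\<delta> > 0" and th: "\<theta> > 0" and rho: "K.\<rho> \<le> 1"
  shows "\<forall>\<^sub>F n in sequentially. \<forall>i j. 1 \<le> i \<longrightarrow> 1 \<le> j \<longrightarrow> i \<noteq> j \<longrightarrow>
     exp (- (\<theta>\<^sup>2 / 2 + \<theta> * \<delta> + \<delta>\<^sup>2) * L n) \<le> prob (good_at L \<theta> \<delta> n i j)"
proof -
  \<comment> \<open>The further tilt gains at least \<open>\<delta>\<^sup>2 / 2 = 4 * \<kappa>\<close> in the exponent, of which \<open>2 * \<kappa>\<close> is spent on the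
    errors of the moment asymptotics.\<close>
  define \<kappa> where "\<kappa> = \<delta>\<^sup>2 / 8"
  have k: "\<kappa> > 0" using d by (simp add: \<kappa>_def)
  have "\<forall>\<^sub>F n in sequentially. L n \<ge> 4 * ln 8 / \<delta>\<^sup>2" using L by (simp add: filterlim_at_top)
  then show ?thesis
    using exp_moment_bounds_pair[OF L Ln k, of \<theta> 0] exp_moment_bounds_pair[OF L Ln k, of "\<theta> + \<delta>" 0]
      exp_moment_bounds_pair[OF L Ln k, of "\<theta> - \<delta>" 0] exp_moment_bounds_pair[OF L Ln k, of \<theta> \<delta>]
  proof eventually_elim
    case (elim n)
    have "4 * ln 8 / \<delta>\<^sup>2 \<ge> (0 :: real)" by simp
    then have L0: "L n \<ge> 0" using elim(1) by linarith
    have L8: "8 \<le> exp (\<delta>\<^sup>2 / 4 * L n)"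
    proof -
      have "ln 8 \<le> \<delta>\<^sup>2 / 4 * L n" using elim(1) d by (simp add: field_simps)
      then have "exp (ln 8) \<le> exp (\<delta>\<^sup>2 / 4 * L n)" by (simp only: exp_le_cancel_iff)
      then show ?thesis by simp
    qed
    show ?case
    proof (intro allI impI)
      fix i j :: nat assume ij: "1 \<le> i" "1 \<le> j" "i \<noteq> j"
      define T where "T = S (scale L n) n i j"
      define G where "G = \<Gamma> (scale L n) n i"
      define G' where "G' = \<Gamma> (scale L n) n j"
      define x u a where "x = (\<theta> - \<delta>) * L n" and "u = (\<theta> + \<delta>) * L n" and "a = (K.\<rho> * \<theta> + \<delta>) * L n"
      define A where "A = good (scale L n) n x u a i j"
      define B where "B = exp ((\<theta>\<^sup>2 / 2 - 3 * \<kappa>) * L n)"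
      have Am[measurable]: "A \<in> events" unfolding A_def using ij by simp
      have Tj: "S (scale L n) n j i = T" unfolding T_def by (rule S_sym)
      note e1 = elim(2)[rule_format, OF ij, unfolded Let_def, folded T_def]
      note e2 = elim(3)[rule_format, OF ij, unfolded Let_def, folded T_def]
      note e3 = elim(4)[rule_format, OF ij, unfolded Let_def, folded T_def]
      note e4 = elim(5)[rule_format, OF ij, unfolded Let_def, folded T_def G_def]
      note e5 = elim(5)[rule_format, OF ij(2,1) ij(3)[symmetric], unfolded Let_def Tj, folded G'_def]
      have V1: "(K.V \<theta> 0 0 / 2 - \<kappa>) * L n = (\<theta>\<^sup>2 / 2 - \<kappa>) * L n"
        and V2: "(K.V (\<theta> + \<delta>) 0 0 / 2 + \<kappa>) * L n = (\<theta>\<^sup>2 / 2 - 3 * \<kappa>) * L n + \<delta> * u"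
        and V3: "(K.V (\<theta> - \<delta>) 0 0 / 2 + \<kappa>) * L n = (\<theta>\<^sup>2 / 2 - 3 * \<kappa>) * L n - \<delta> * x"
        by (simp_all add: K.V_def u_def x_def \<kappa>_def power2_eq_square field_simps)
      have V4: "(K.V \<theta> 0 \<delta> / 2 + \<kappa>) * L n \<le> (\<theta>\<^sup>2 / 2 - 3 * \<kappa>) * L n + \<delta> * a"
      proof -
        have "K.V \<theta> 0 \<delta> / 2 + \<kappa> = \<theta>\<^sup>2 / 2 - 3 * \<kappa> + \<delta> * (K.\<rho> * \<theta> + \<delta>) - \<delta>\<^sup>2 / 2 * (1 - K.\<rho>)"
          by (simp add: K.V_def \<kappa>_def power2_eq_square field_simps)
        then have "K.V \<theta> 0 \<delta> / 2 + \<kappa> \<le> \<theta>\<^sup>2 / 2 - 3 * \<kappa> + \<delta> * (K.\<rho> * \<theta> + \<delta>)"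
          using rho by simp
        from mult_right_mono[OF this L0] show ?thesis by (simp add: a_def algebra_simps)
      qed
      have pw: "exp (\<theta> * T \<omega>) \<le> exp (\<theta> * u) * indicator A \<omega>
          + exp (- (\<delta> * u)) * exp ((\<theta> + \<delta>) * T \<omega>) + exp (\<delta> * x) * exp ((\<theta> - \<delta>) * T \<omega>)
          + exp (- (\<delta> * a)) * exp (\<theta> * T \<omega> + \<delta> * G \<omega>)
          + exp (- (\<delta> * a)) * exp (\<theta> * T \<omega> + \<delta> * G' \<omega>)" (is "?l \<le> ?t0 + ?t1 + ?t2 + ?t3 + ?t4")
        if w: "\<omega> \<in> space M" for \<omega>
      proof -
        have nn: "0 \<le> ?t0" "0 \<le> ?t1" "0 \<le> ?t2" "0 \<le> ?t3" "0 \<le> ?t4" by auto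
        consider "\<omega> \<in> A" | "u < T \<omega>" | "T \<omega> < x" | "a < G \<omega>" | "a < G' \<omega>"
          using w unfolding A_def good_def T_def[symmetric] G_def[symmetric] G'_def[symmetric] by force
        then have "?l \<le> ?t0 \<or> ?l \<le> ?t1 \<or> ?l \<le> ?t2 \<or> ?l \<le> ?t3 \<or> ?l \<le> ?t4"
        proof cases
          case 1
          then have "T \<omega> \<le> u" by (simp add: A_def good_def T_def)
          then have "?l \<le> ?t0" using 1 th d by simp
          then show ?thesis by blast
        next
          case 2
          then have "\<delta> * u \<le> \<delta> * T \<omega>" using d by simp
          then have "?l \<le> ?t1" by (simp add: mult_exp_exp algebra_simps)
          then show ?thesis by blast
        next
          case 3
          then have "\<delta> * T \<omega> \<le> \<delta> * x" using d by simp
          then have "?l \<le> ?t2" by (simp add: mult_exp_exp algebra_simps)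
          then show ?thesis by blast
        next
          case 4
          then have "\<delta> * a \<le> \<delta> * G \<omega>" using d by simp
          then have "?l \<le> ?t3" by (simp add: mult_exp_exp algebra_simps)
          then show ?thesis by blast
        next
          case 5
          then have "\<delta> * a \<le> \<delta> * G' \<omega>" using d by simp
          then have "?l \<le> ?t4" by (simp add: mult_exp_exp algebra_simps)
          then show ?thesis by blast
        qed
        then show ?thesis using nn by linarith
      qed
      have i: "integrable M (\<lambda>\<omega>. exp (\<theta> * T \<omega>))" "integrable M (\<lambda>\<omega>. exp ((\<theta> + \<delta>) * T \<omega>))"
          "integrable M (\<lambda>\<omega>. exp ((\<theta> - \<delta>) * T \<omega>))" "integrable M (\<lambda>\<omega>. exp (\<theta> * T \<omega> + \<delta> * G \<omega>))"
          "integrable M (\<lambda>\<omega>. exp (\<theta> * T \<omega> + \<delta> * G' \<omega>))"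
        using e1 e2 e3 e4 e5 by simp_all
      have iA: "integrable M (indicator A :: 'a \<Rightarrow> real)" using Am by (simp add: emeasure_eq_measure)
      have "exp ((\<theta>\<^sup>2 / 2 - \<kappa>) * L n) \<le> expectation (\<lambda>\<omega>. exp (\<theta> * T \<omega>))"
        using e1 V1 by simp
      also have "\<dots> \<le> expectation (\<lambda>\<omega>. exp (\<theta> * u) * indicator A \<omega>
          + exp (- (\<delta> * u)) * exp ((\<theta> + \<delta>) * T \<omega>) + exp (\<delta> * x) * exp ((\<theta> - \<delta>) * T \<omega>)
          + exp (- (\<delta> * a)) * exp (\<theta> * T \<omega> + \<delta> * G \<omega>)
          + exp (- (\<delta> * a)) * exp (\<theta> * T \<omega> + \<delta> * G' \<omega>))"
        using pw i iA by (intro integral_mono) auto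
      also have "\<dots> = exp (\<theta> * u) * prob A
          + exp (- (\<delta> * u)) * expectation (\<lambda>\<omega>. exp ((\<theta> + \<delta>) * T \<omega>))
          + exp (\<delta> * x) * expectation (\<lambda>\<omega>. exp ((\<theta> - \<delta>) * T \<omega>))
          + exp (- (\<delta> * a)) * expectation (\<lambda>\<omega>. exp (\<theta> * T \<omega> + \<delta> * G \<omega>))
          + exp (- (\<delta> * a)) * expectation (\<lambda>\<omega>. exp (\<theta> * T \<omega> + \<delta> * G' \<omega>))"
        using i iA by simp
      also have "\<dots> \<le> exp (\<theta> * u) * prob A + B + B + B + B"
      proof (intro add_mono order_refl)
        have *: "exp (- c) * E \<le> B" if "E \<le> exp w" "w \<le> (\<theta>\<^sup>2 / 2 - 3 * \<kappa>) * L n + c" for c w E :: real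
        proof -
          have "exp (- c) * E \<le> exp (- c) * exp w" using that by (intro mult_left_mono) auto
          also have "\<dots> \<le> B" unfolding B_def mult_exp_exp exp_le_cancel_iff using that by simp
          finally show ?thesis .
        qed
        show "exp (- (\<delta> * u)) * expectation (\<lambda>\<omega>. exp ((\<theta> + \<delta>) * T \<omega>)) \<le> B"
          using e2 V2 by (intro *) auto
        show "exp (\<delta> * x) * expectation (\<lambda>\<omega>. exp ((\<theta> - \<delta>) * T \<omega>)) \<le> B"
          using e3 V3 *[of _ "(K.V (\<theta> - \<delta>) 0 0 / 2 + \<kappa>) * L n" "- (\<delta> * x)"] by auto
        show "exp (- (\<delta> * a)) * expectation (\<lambda>\<omega>. exp (\<theta> * T \<omega> + \<delta> * G \<omega>)) \<le> B"
          using e4 V4 by (intro *) auto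
        show "exp (- (\<delta> * a)) * expectation (\<lambda>\<omega>. exp (\<theta> * T \<omega> + \<delta> * G' \<omega>)) \<le> B"
          using e5 V4 by (intro *) auto
      qed
      finally have main: "exp ((\<theta>\<^sup>2 / 2 - \<kappa>) * L n) \<le> exp (\<theta> * u) * prob A + 4 * B" by simp
      have B8: "8 * B \<le> exp ((\<theta>\<^sup>2 / 2 - \<kappa>) * L n)"
      proof -
        have "8 * B \<le> exp (\<delta>\<^sup>2 / 4 * L n) * B" using L8 by (intro mult_right_mono) (auto simp: B_def)
        also have "\<dots> = exp ((\<theta>\<^sup>2 / 2 - \<kappa>) * L n)"
          by (simp add: B_def mult_exp_exp \<kappa>_def algebra_simps)
        finally show ?thesis .
      qed
      then have "exp ((\<theta>\<^sup>2 / 2 - \<kappa>) * L n) \<le> 2 * (exp (\<theta> * u) * prob A)" using main by linarith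
      also have "\<dots> \<le> exp (\<delta>\<^sup>2 / 4 * L n) * (exp (\<theta> * u) * prob A)"
        using L8 by (intro mult_right_mono) auto
      finally have "exp (- (\<delta>\<^sup>2 / 4 * L n) - \<theta> * u) * exp ((\<theta>\<^sup>2 / 2 - \<kappa>) * L n)
          \<le> exp (- (\<delta>\<^sup>2 / 4 * L n) - \<theta> * u) * (exp (\<delta>\<^sup>2 / 4 * L n) * (exp (\<theta> * u) * prob A))"
        by (intro mult_left_mono) auto
      also have "\<dots> = prob A" by (simp add: mult.assoc[symmetric] mult_exp_exp)
      finally have "exp (- (\<delta>\<^sup>2 / 4 * L n) - \<theta> * u + (\<theta>\<^sup>2 / 2 - \<kappa>) * L n) \<le> prob A"
        by (simp add: mult_exp_exp)
      moreover have "- (\<theta>\<^sup>2 / 2 + \<theta> * \<delta> + \<delta>\<^sup>2) * L n \<le> - (\<delta>\<^sup>2 / 4 * L n) - \<theta> * u + (\<theta>\<^sup>2 / 2 - \<kappa>) * L n"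
      proof -
        have "- (\<delta>\<^sup>2 / 4 * L n) - \<theta> * u + (\<theta>\<^sup>2 / 2 - \<kappa>) * L n
            = - (\<theta>\<^sup>2 / 2 + \<theta> * \<delta> + \<delta>\<^sup>2) * L n + 5 / 8 * \<delta>\<^sup>2 * L n"
          by (simp add: u_def \<kappa>_def field_simps power2_eq_square)
        then show ?thesis using L0 by simp
      qed
      ultimately show "exp (- (\<theta>\<^sup>2 / 2 + \<theta> * \<delta> + \<delta>\<^sup>2) * L n) \<le> prob (good_at L \<theta> \<delta> n i j)"
        unfolding A_def x_def u_def a_def
        by (meson exp_le_cancel_iff order_trans)
    qed
  qed
qed

text \<open>The Chernoff bound with the weights \<open>\<theta>, \<theta>, - \<theta>\<close>. For Gaussian variables the most likely way
  to have both statistics at \<open>\<theta> * L\<close>, with the common projection at most \<open>\<rho> * \<theta> * L\<close>, puts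
  the projection on its boundary, and these weights are the corresponding Lagrange multipliers.
  The negative weight is the gain from the truncation.\<close>

lemma good_overlap_upper:
  fixes L :: "nat \<Rightarrow> real"
  assumes L: "filterlim L at_top sequentially" and Ln: "(\<lambda>n. L n / n) \<longlonglongrightarrow> 0"
    and d: "\<delta> > 0" and th: "\<theta> > 0"
  shows "\<forall>\<^sub>F n in sequentially. \<forall>a b c. 1 \<le> a \<longrightarrow> 1 \<le> b \<longrightarrow> 1 \<le> c \<longrightarrow> a \<noteq> b \<longrightarrow> a \<noteq> c \<longrightarrow> b \<noteq> c \<longrightarrow>
     prob (good_at L \<theta> \<delta> n a b \<inter> good_at L \<theta> \<delta> n a c)
       \<le> exp ((- \<theta>\<^sup>2 * (1 - K.\<rho> / 2) + 3 * \<theta> * \<delta> + \<delta>\<^sup>2) * L n)"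
proof -
  have "\<delta>\<^sup>2 > 0" using d by simp
  from exp_moment_growth[OF L Ln this, of \<theta> \<theta> "- \<theta>"] show ?thesis
  proof eventually_elim
    case (elim n)
    show ?case
    proof (intro allI impI)
      fix a b c :: nat
      assume abc: "1 \<le> a" "1 \<le> b" "1 \<le> c" "a \<noteq> b" "a \<noteq> c" "b \<noteq> c"
      let ?A = "good_at L \<theta> \<delta> n a b \<inter> good_at L \<theta> \<delta> n a c"
      define W where "W = (\<lambda>\<omega>. \<theta> * S (scale L n) n a b \<omega> + \<theta> * S (scale L n) n a c \<omega> + - \<theta> * \<Gamma> (scale L n) n a \<omega>)"
      define w where "w = \<theta> * ((\<theta> - \<delta>) * L n) + \<theta> * ((\<theta> - \<delta>) * L n) - \<theta> * ((K.\<rho> * \<theta> + \<delta>) * L n)"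
      have W: "integrable M (\<lambda>\<omega>. exp (W \<omega>))"
        "expectation (\<lambda>\<omega>. exp (W \<omega>)) \<le> exp ((K.V \<theta> \<theta> (- \<theta>) / 2 + \<delta>\<^sup>2) * L n)"
        using elim[rule_format, OF abc] unfolding Let_def W_def by auto
      have "prob ?A \<le> exp (- w) * expectation (\<lambda>\<omega>. exp (W \<omega>))"
      proof (rule chernoff_bound[OF W(1)])
        show "?A \<in> events" using abc by (intro sets.Int good_measurable) auto
        fix \<omega> assume "\<omega> \<in> ?A"
        then have h: "(\<theta> - \<delta>) * L n \<le> S (scale L n) n a b \<omega>" "(\<theta> - \<delta>) * L n \<le> S (scale L n) n a c \<omega>"
          "\<Gamma> (scale L n) n a \<omega> \<le> (K.\<rho> * \<theta> + \<delta>) * L n" by (auto simp: good_def)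
        show "w \<le> W \<omega>"
          using mult_left_mono[OF h(1), of \<theta>] mult_left_mono[OF h(2), of \<theta>] mult_left_mono[OF h(3), of \<theta>] th
          unfolding w_def W_def by linarith
      qed
      also have "\<dots> \<le> exp (- w) * exp ((K.V \<theta> \<theta> (- \<theta>) / 2 + \<delta>\<^sup>2) * L n)"
        using W(2) by (intro mult_left_mono) auto
      also have "\<dots> = exp ((- \<theta>\<^sup>2 * (1 - K.\<rho> / 2) + 3 * \<theta> * \<delta> + \<delta>\<^sup>2) * L n)"
        unfolding mult_exp_exp w_def by (simp add: K.V_def power2_eq_square field_simps)
      finally show "prob ?A \<le> exp ((- \<theta>\<^sup>2 * (1 - K.\<rho> / 2) + 3 * \<theta> * \<delta> + \<delta>\<^sup>2) * L n)" .
    qed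
  qed
qed

text \<open>The second moment method, applied to pairs with one index in the lower and one in the upper half of
  \<open>{1..p n}\<close>. Two such pairs share an index only in the same position, and each overlaps with at most
  \<open>p n\<close> others, while their number is still at least \<open>p n * p n / 8\<close>.\<close>

lemma max_lower:
  fixes p :: "nat \<Rightarrow> nat"
  defines "L \<equiv> \<lambda>n. ln (real (p n))"
  assumes L: "filterlim L at_top sequentially" and Ln: "(\<lambda>n. L n / n) \<longlonglongrightarrow> 0"
    and rho: "K.\<rho> \<le> 1/2" and t: "0 < \<tau>" "\<tau> \<le> 1"
  shows "(\<lambda>n. prob {\<omega>\<in>space M. \<forall>i j. 1 \<le> i \<longrightarrow> i < j \<longrightarrow> j \<le> p n \<longrightarrow>
            S (scale L n) n i j \<omega> < (2 - 2 * \<tau>) * L n}) \<longlonglongrightarrow> 0"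
proof -
  \<comment> \<open>The slack \<open>\<tau>\<close> in \<open>\<theta>\<close> has to dominate all terms with \<open>\<delta>\<close>. The numbers \<open>kq\<close> and \<open>kr\<close> are minus the
    exponents of a single event and of two overlapping events.\<close>
  define \<theta> \<delta> where "\<theta> = 2 - \<tau>" and "\<delta> = \<tau> / 20"
  define kq where "kq = \<theta>\<^sup>2 / 2 + \<theta> * \<delta> + \<delta>\<^sup>2"
  define kr where "kr = \<theta>\<^sup>2 * (1 - K.\<rho> / 2) - 3 * \<theta> * \<delta> - \<delta>\<^sup>2"
  have d: "\<delta> > 0" and th: "\<theta> > 0" using t by (auto simp: \<theta>_def \<delta>_def)
  have rho1: "K.\<rho> \<le> 1" using rho by linarith
  have tt: "0 < \<tau> * \<tau>" "\<tau> * \<tau> \<le> \<tau>" using t by (auto simp: mult_left_le)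
  have "kq = 2 - 19 / 10 * \<tau> + 181 / 400 * (\<tau> * \<tau>)"
    by (simp add: kq_def \<theta>_def \<delta>_def power2_eq_square field_simps)
  then have k1: "0 < 2 - kq" using t tt by linarith
  have k2: "0 < 1 + kr - 2 * kq"
  proof -
    have "\<theta>\<^sup>2 * K.\<rho> \<le> \<theta>\<^sup>2 * (1/2)" using rho by (intro mult_left_mono) auto
    then have "1 + kr - 2 * kq \<ge> 1 - \<theta>\<^sup>2 / 4 - 5 * \<theta> * \<delta> - 3 * \<delta>\<^sup>2"
      by (simp add: kr_def kq_def algebra_simps)
    moreover have "1 - \<theta>\<^sup>2 / 4 - 5 * \<theta> * \<delta> - 3 * \<delta>\<^sup>2 = \<tau> / 2 - 3 / 400 * (\<tau> * \<tau>)"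
      by (simp add: \<theta>_def \<delta>_def power2_eq_square field_simps)
    ultimately show ?thesis using t tt by linarith
  qed
  have lim: "(\<lambda>n. 8 * exp (- (2 - kq) * L n) + 8 * exp (- (1 + kr - 2 * kq) * L n)) \<longlonglongrightarrow> 8 * 0 + 8 * 0"
    by (intro tendsto_intros exp_neg_tendsto_0[OF L] k1 k2)
  then have lim: "(\<lambda>n. 8 * exp (- (2 - kq) * L n) + 8 * exp (- (1 + kr - 2 * kq) * L n)) \<longlonglongrightarrow> 0" by simp
  have "\<forall>\<^sub>F n in sequentially. L n > ln 2" using L by (simp add: filterlim_at_top_dense)
  then have "\<forall>\<^sub>F n in sequentially. prob {\<omega>\<in>space M. \<forall>i j. 1 \<le> i \<longrightarrow> i < j \<longrightarrow> j \<le> p n \<longrightarrow>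
            S (scale L n) n i j \<omega> < (2 - 2 * \<tau>) * L n}
       \<le> 8 * exp (- (2 - kq) * L n) + 8 * exp (- (1 + kr - 2 * kq) * L n)"
    using good_prob_lower[OF L Ln d th rho1] good_overlap_upper[OF L Ln d th]
  proof eventually_elim
    case (elim n)
    have p0: "p n \<noteq> 0" using elim(1) by (cases "p n = 0") (auto simp: L_def)
    have pn: "real (p n) = exp (L n)" using p0 by (simp add: L_def)
    have "ln 2 < ln (real (p n))" using elim(1) by (simp add: L_def)
    then have p2: "2 \<le> p n" using p0 by simp
    have L0: "0 < L n" using elim(1) ln_gt_zero[of "2::real"] by linarith
    define m where "m = p n div 2"
    define I where "I = {1..m} \<times> {m+1..p n}"
    define A where "A = (\<lambda>(i, j). good_at L \<theta> \<delta> n i j)"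
    define R where "R e f \<longleftrightarrow> fst e = fst f \<or> snd e = snd f" for e f :: "nat \<times> nat"
    define q where "q = exp (- kq * L n)"
    define r where "r = exp (- kr * L n)"
    have m: "1 \<le> m" "m < p n" using p2 by (auto simp: m_def)
    have finI: "finite I" and neI: "I \<noteq> {}" using m by (auto simp: I_def)
    have cI: "exp (2 * L n) \<le> 8 * real (card I)"
    proof -
      have "card I = m * (p n - m)" by (simp add: I_def)
      moreover have "p n \<le> 4 * m" "p n \<le> 2 * (p n - m)" using p2 by (auto simp: m_def)
      then have "p n * p n \<le> (4 * m) * (2 * (p n - m))" by (rule mult_le_mono)
      ultimately have "p n * p n \<le> 8 * card I" by simp
      then have "real (p n * p n) \<le> real (8 * card I)" by (simp only: of_nat_le_iff)
      then show ?thesis by (simp add: pn mult_exp_exp)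
    qed
    have cI0: "0 < card I" using finI neI by (simp add: card_gt_0_iff)
    have q0: "0 < q" by (simp add: q_def)
    have "prob {\<omega>\<in>space M. \<forall>i j. 1 \<le> i \<longrightarrow> i < j \<longrightarrow> j \<le> p n \<longrightarrow> S (scale L n) n i j \<omega> < (2 - 2 * \<tau>) * L n}
        \<le> prob (space M - (\<Union>e\<in>I. A e))"
    proof (rule finite_measure_mono)
      have "(2 - 2 * \<tau>) * L n \<le> (\<theta> - \<delta>) * L n"
        using t L0 by (intro mult_right_mono) (auto simp: \<theta>_def \<delta>_def)
      note x_le = this
      show "{\<omega>\<in>space M. \<forall>i j. 1 \<le> i \<longrightarrow> i < j \<longrightarrow> j \<le> p n \<longrightarrow> S (scale L n) n i j \<omega> < (2 - 2 * \<tau>) * L n}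
        \<subseteq> space M - (\<Union>e\<in>I. A e)"
      proof (intro subsetI DiffI notI, simp)
        fix \<omega> assume small: "\<omega> \<in> {\<omega>\<in>space M. \<forall>i j. 1 \<le> i \<longrightarrow> i < j \<longrightarrow> j \<le> p n \<longrightarrow>
            S (scale L n) n i j \<omega> < (2 - 2 * \<tau>) * L n}" and "\<omega> \<in> (\<Union>e\<in>I. A e)"
        then obtain i j where "(i, j) \<in> I" "\<omega> \<in> A (i, j)" by auto
        then have "1 \<le> i" "i < j" "j \<le> p n" "(\<theta> - \<delta>) * L n \<le> S (scale L n) n i j \<omega>"
          by (simp_all add: I_def A_def good_def)
        with small x_le show False by fastforce
      qed
      show "space M - (\<Union>e\<in>I. A e) \<in> events"
        using finI by (intro sets.Diff sets.finite_UN sets.top) (auto simp: A_def I_def)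
    qed
    also have "\<dots> \<le> 1 / (card I * q) + real (p n) * r / (card I * q\<^sup>2)"
    proof (rule second_moment_method[OF finI neI, where R = R])
      show "A e \<in> events" if "e \<in> I" for e using that by (auto simp: A_def I_def)
      show "0 < q" "0 \<le> r" by (auto simp: q_def r_def)
      show "q \<le> prob (A e)" if "e \<in> I" for e
        using that elim(2) by (auto simp: q_def kq_def A_def I_def)
      show "prob (A e \<inter> A f) = prob (A e) * prob (A f)" if "e \<in> I" "f \<in> I" "\<not> R e f" for e f
        using that by (auto simp: A_def I_def R_def intro!: good_indep)
      show "real (card {f \<in> I. R e f}) \<le> real (p n)" if "e \<in> I" for e
      proof -
        obtain i j where e: "e = (i, j)" by (cases e)
        have "{f \<in> I. R e f} \<subseteq> (\<lambda>j'. (i, j')) ` {m+1..p n} \<union> (\<lambda>i'. (i', j)) ` {1..m}"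
          by (auto simp: I_def R_def e)
        then have "card {f \<in> I. R e f} \<le> card ((\<lambda>j'. (i, j')) ` {m+1..p n} \<union> (\<lambda>i'. (i', j)) ` {1..m})"
          by (intro card_mono) auto
        also have "\<dots> \<le> (p n - m) + m"
          by (intro order_trans[OF card_Un_le] add_mono order_trans[OF card_image_le]) auto
        also have "\<dots> = p n" using m by simp
        finally show ?thesis by simp
      qed
      show "prob (A e \<inter> A f) \<le> r" if ef: "e \<in> I" "f \<in> I" "e \<noteq> f" "R e f" for e f
      proof -
        obtain i j i' j' where e: "e = (i, j)" "f = (i', j')" by (cases e, cases f)
        have r: "r = exp ((- \<theta>\<^sup>2 * (1 - K.\<rho> / 2) + 3 * \<theta> * \<delta> + \<delta>\<^sup>2) * L n)"
          by (simp add: r_def kr_def algebra_simps)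
        from ef e consider "i = i'" "j \<noteq> j'" | "j = j'" "i \<noteq> i'" by (auto simp: R_def)
        then show ?thesis
        proof cases
          case 1
          then show ?thesis using elim(3)[rule_format, of i j j'] ef
            by (auto simp: e A_def I_def r)
        next
          case 2
          then have "prob (good_at L \<theta> \<delta> n j i \<inter> good_at L \<theta> \<delta> n j i') \<le> r"
            unfolding r using ef by (intro elim(3)[rule_format]) (auto simp: e I_def)
          then show ?thesis
            unfolding good_sym[of _ _ _ _ _ j i] good_sym[of _ _ _ _ _ j i'] using 2 by (simp add: e A_def)
        qed
      qed
    qed
    also have "1 / (card I * q) \<le> 8 * exp (- (2 - kq) * L n)"
    proof -
      have "exp (2 * L n) / 8 * q \<le> card I * q" using cI q0 by (intro mult_right_mono) auto
      then have "1 / (card I * q) \<le> 1 / (exp (2 * L n) / 8 * q)"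
        using q0 by (intro divide_left_mono) (use cI0 in auto)
      also have "\<dots> = 8 * exp (- (2 - kq) * L n)"
      proof -
        have "exp (2 * L n) * q = exp ((2 - kq) * L n)" by (simp add: q_def mult_exp_exp algebra_simps)
        then have "1 / (exp (2 * L n) / 8 * q) = 8 * (exp 0 / exp ((2 - kq) * L n))" by simp
        also have "\<dots> = 8 * exp (0 - (2 - kq) * L n)" by (simp only: exp_diff)
        finally show ?thesis by (simp add: algebra_simps)
      qed
      finally show ?thesis .
    qed
    also have "real (p n) * r / (card I * q\<^sup>2) \<le> 8 * exp (- (1 + kr - 2 * kq) * L n)"
    proof -
      have "exp (2 * L n) / 8 * q\<^sup>2 \<le> card I * q\<^sup>2" using cI q0 by (intro mult_right_mono) auto
      then have "real (p n) * r / (card I * q\<^sup>2) \<le> real (p n) * r / (exp (2 * L n) / 8 * q\<^sup>2)"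
        using q0 by (intro divide_left_mono) (use cI0 in \<open>auto simp: r_def\<close>)
      also have "\<dots> = 8 * exp (- (1 + kr - 2 * kq) * L n)"
      proof -
        have "exp (2 * L n) * q\<^sup>2 = exp ((2 - 2 * kq) * L n)"
          by (simp add: q_def power2_eq_square mult_exp_exp algebra_simps)
        moreover have "real (p n) * r = exp ((1 - kr) * L n)"
          by (simp add: pn r_def mult_exp_exp algebra_simps)
        ultimately have "real (p n) * r / (exp (2 * L n) / 8 * q\<^sup>2)
            = 8 * (exp ((1 - kr) * L n) / exp ((2 - 2 * kq) * L n))" by simp
        also have "\<dots> = 8 * exp ((1 - kr) * L n - (2 - 2 * kq) * L n)" by (simp only: exp_diff)
        finally show ?thesis by (simp add: algebra_simps)
      qed
      finally show ?thesis .
    qed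
    finally show ?case by simp
  qed
  then show ?thesis by (rule tendsto_sandwich[OF always_eventually _ tendsto_const lim, rotated]) simp
qed

end

section \<open>The maximum of the statistics\<close>

lemma standardisation_is_iid_kernel_array:
  fixes f :: "real \<times> real \<Rightarrow> real"
  assumes M: "prob_space M" and iid: "iid_array M X" and f[measurable]: "f \<in> borel_measurable borel"
    and sym: "\<And>x y. f (x, y) = f (y, x)"
    and sq: "integrable M (\<lambda>\<omega>. (f (X 1 1 \<omega>, X 2 1 \<omega>))\<^sup>2)"
    and var: "prob_space.variance M (\<lambda>\<omega>. f (X 1 1 \<omega>, X 2 1 \<omega>)) > 0"
    and h: "h > 0" and e: "integrable M (\<lambda>\<omega>. exp (h * \<bar>Zvar M f X 1 2 1 \<omega>\<bar>))"
  defines "m \<equiv> prob_space.expectation M (\<lambda>\<omega>. f (X 1 1 \<omega>, X 2 1 \<omega>))"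
    and "v \<equiv> prob_space.variance M (\<lambda>\<omega>. f (X 1 1 \<omega>, X 2 1 \<omega>))"
  shows "iid_kernel_array M (distr M borel (X 1 1)) (\<lambda>y. (f y - m) / sqrt v) h X"
proof -
  interpret M: prob_space M by fact
  let ?\<mu> = "distr M borel (X 1 1)"
  let ?z = "\<lambda>y. (f y - m) / sqrt v"
  have X[measurable]: "X i t \<in> borel_measurable M" if "1 \<le> i" "1 \<le> t" for i t
    using M.iid_array_measurable[OF iid that] .
  have X1[measurable]: "X 1 1 \<in> borel_measurable M" and X2[measurable]: "X 2 1 \<in> borel_measurable M"
    by (auto intro!: X)
  have pm[measurable]: "(\<lambda>\<omega>. (X 1 1 \<omega>, X 2 1 \<omega>)) \<in> measurable M (borel \<Otimes>\<^sub>M borel)" by measurable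
  have fm[measurable]: "f \<in> borel_measurable (borel \<Otimes>\<^sub>M borel)" unfolding borel_prod by measurable
  note d = M.iid_array_pair_distr[OF iid]
  have int: "(\<integral>y. F y \<partial>(?\<mu> \<Otimes>\<^sub>M ?\<mu>)) = M.expectation (\<lambda>\<omega>. F (X 1 1 \<omega>, X 2 1 \<omega>))"
    and intble: "integrable (?\<mu> \<Otimes>\<^sub>M ?\<mu>) F = integrable M (\<lambda>\<omega>. F (X 1 1 \<omega>, X 2 1 \<omega>))"
    if "F \<in> borel_measurable (borel \<Otimes>\<^sub>M borel)" for F :: "real \<times> real \<Rightarrow> real"
    unfolding d[symmetric] using integral_distr[OF pm that] integrable_distr_eq[OF pm that] by auto
  have fi: "integrable M (\<lambda>\<omega>. f (X 1 1 \<omega>, X 2 1 \<omega>))"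
    by (rule M.square_integrable_imp_integrable[OF _ sq]) measurable
  have mu: "prob_space ?\<mu>" by (rule M.prob_space_distr[OF X1])
  have "standardised_kernel ?\<mu> ?z h"
  proof (intro standardised_kernel.intro[OF mu] standardised_kernel_axioms.intro)
    show "sets ?\<mu> = sets borel" by simp
    show "?z \<in> borel_measurable borel" by measurable
    show "?z (x, y) = ?z (y, x)" for x y by (simp add: sym[of x y])
    show "h > 0" by (rule h)
    show "integrable (?\<mu> \<Otimes>\<^sub>M ?\<mu>) (\<lambda>y. exp (h * \<bar>?z y\<bar>))"
      using e by (subst intble) (auto simp: Zvar_def m_def v_def)
    show "(\<integral>y. ?z y \<partial>(?\<mu> \<Otimes>\<^sub>M ?\<mu>)) = 0"
      using fi by (subst int) (auto simp: m_def M.prob_space)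
    have "(\<integral>y. (?z y)\<^sup>2 \<partial>(?\<mu> \<Otimes>\<^sub>M ?\<mu>)) = M.expectation (\<lambda>\<omega>. (f (X 1 1 \<omega>, X 2 1 \<omega>) - m)\<^sup>2 / v)"
      using var by (subst int) (auto simp: power_divide v_def)
    also have "\<dots> = v / v" by (simp add: v_def m_def)
    also have "\<dots> = 1" using var by (simp add: v_def)
    finally show "(\<integral>y. (?z y)\<^sup>2 \<partial>(?\<mu> \<Otimes>\<^sub>M ?\<mu>)) = 1" .
  qed
  then show ?thesis
    by (intro iid_kernel_array.intro iid_kernel_array_axioms.intro M iid refl)
qed

text \<open>For \<open>p \<ge> 3\<close> and \<open>n \<ge> 1\<close> the argument of the logarithm in the hypothesis is at least \<open>p\<close>, and
  \<open>ln p \<ge> 1\<close> gives \<open>ln p \<le> (ln p) ^ 7\<close>.\<close>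

lemma growth_condition_imp_ln_small:
  fixes p :: "nat \<Rightarrow> nat"
  assumes p: "filterlim p at_top sequentially" and c: "c > 0"
    and bd: "\<And>n. n \<ge> 1 \<Longrightarrow>
           (ln (real (p n) * (real (p n) - 1) / 2 * real n)) ^ 7 / real n \<le> C * real n powr (- c)"
  shows "(\<lambda>n. ln (real (p n)) / real n) \<longlonglongrightarrow> 0"
proof (rule tendsto_sandwich[OF _ _ tendsto_const])
  have "\<forall>\<^sub>F n in sequentially. p n \<ge> 3" using p by (simp add: filterlim_at_top)
  then show "\<forall>\<^sub>F n in sequentially. ln (real (p n)) / real n \<le> C * real n powr (- c)"
    using eventually_ge_at_top[of 1]
  proof eventually_elim
    case (elim n)
    let ?P = "real (p n)"
    have P: "?P \<ge> 3" using elim by simp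
    have "exp 1 \<le> ?P" using exp_le P by linarith
    then have l1: "1 \<le> ln ?P" using P by (simp add: ln_ge_iff)
    have "?P * 1 \<le> ?P * ((?P - 1) / 2 * real n)"
    proof (intro mult_left_mono)
      have "1 * 1 \<le> (?P - 1) / 2 * real n" using P elim by (intro mult_mono) auto
      then show "1 \<le> (?P - 1) / 2 * real n" by simp
    qed simp
    then have "ln ?P \<le> ln (?P * (?P - 1) / 2 * real n)" using P by (intro ln_mono) auto
    then have "ln ?P ^ 7 \<le> ln (?P * (?P - 1) / 2 * real n) ^ 7" using l1 by (intro power_mono) auto
    moreover have "ln ?P \<le> ln ?P ^ 7" using l1 power_increasing[of 1 7 "ln ?P"] by simp
    ultimately have "ln ?P / real n \<le> ln (?P * (?P - 1) / 2 * real n) ^ 7 / real n"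
      by (intro divide_right_mono) auto
    also have "\<dots> \<le> C * real n powr (- c)" using bd elim by blast
    finally show ?case .
  qed
  have "\<forall>\<^sub>F n in sequentially. p n \<ge> 1" using p by (simp add: filterlim_at_top)
  then show "\<forall>\<^sub>F n in sequentially. 0 \<le> ln (real (p n)) / real n"
    by eventually_elim simp
  show "(\<lambda>n. C * real n powr (- c)) \<longlonglongrightarrow> 0" using c by real_asymp
qed

theorem theorem2p14:
  fixes M :: "'a measure" and X :: "nat \<Rightarrow> nat \<Rightarrow> 'a \<Rightarrow> real"
    and f :: "real \<times> real \<Rightarrow> real"
    and N :: "'b measure" and Z :: "'b \<Rightarrow> real"
    and p :: "nat \<Rightarrow> nat" and \<eta> c C :: real
  assumes "prob_space M"
    and "iid_array M X"
    and "f \<in> borel_measurable borel"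
    and "\<And>x y. f (x, y) = f (y, x)"
    and "integrable M (\<lambda>\<omega>. (f (X 1 1 \<omega>, X 2 1 \<omega>))\<^sup>2)"
    and "prob_space.variance M (\<lambda>\<omega>. f (X 1 1 \<omega>, X 2 1 \<omega>)) > 0"
    and "prob_space N" and "Z \<in> borel_measurable N"
    and "distr N borel Z = distr M borel (Zvar M f X 1 2 1)"
    and "filterlim p at_top sequentially"
    and "\<eta> > 0" and "c > 0" and "C > 0"
    and "integrable N (\<lambda>\<omega>. exp (\<eta> * \<bar>Z \<omega>\<bar>))"
    and "\<And>n. n \<ge> 1 \<Longrightarrow>
           (ln (real (p n) * (real (p n) - 1) / 2 * real n)) ^ 7 / real n \<le> C * real n powr (- c)"
    and "rho M f X \<in> {0..1/2}"
  shows "tendsto_in_prob M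
           (\<lambda>n \<omega>. MAX (i, j) \<in> {(i, j). 1 \<le> i \<and> i < j \<and> j \<le> p n}.
              1 / sqrt (ln (real (p n))) * Tstat M f X n i j \<omega>) 2"
proof -
  interpret M: prob_space M by fact
  define m v where "m = M.expectation (\<lambda>\<omega>. f (X 1 1 \<omega>, X 2 1 \<omega>))"
    and "v = M.variance (\<lambda>\<omega>. f (X 1 1 \<omega>, X 2 1 \<omega>))"
  define z where "z = (\<lambda>y. (f y - m) / sqrt v)"
  define \<mu> where "\<mu> = distr M borel (X 1 1)"
  have Zz: "Zvar M f X i j l \<omega> = z (X i l \<omega>, X j l \<omega>)" for i j l \<omega>
    by (simp add: Zvar_def z_def m_def v_def)
  have X: "X i t \<in> borel_measurable M" if "1 \<le> i" "1 \<le> t" for i t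
    using M.iid_array_measurable[OF assms(2) that] .
  have Zm: "Zvar M f X 1 2 1 \<in> borel_measurable M"
  proof -
    have [measurable]: "X 1 1 \<in> borel_measurable M" "X 2 1 \<in> borel_measurable M" by (auto intro!: X)
    have [measurable]: "f \<in> borel_measurable (borel \<Otimes>\<^sub>M borel)" using assms(3) by (simp add: borel_prod)
    show ?thesis unfolding Zvar_def[abs_def] by measurable
  qed
  have "integrable (distr N borel Z) (\<lambda>x. exp (\<eta> * \<bar>x\<bar>))"
    using assms(8,14) by (subst integrable_distr_eq) auto
  then have "integrable M (\<lambda>\<omega>. exp (\<eta> * \<bar>Zvar M f X 1 2 1 \<omega>\<bar>))"
    unfolding assms(9) using Zm by (subst (asm) integrable_distr_eq) auto
  from standardisation_is_iid_kernel_array[OF assms(1-6) assms(11) this]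
  interpret iid_kernel_array M \<mu> z \<eta> X
    unfolding \<mu>_def z_def m_def v_def .
  have rho: "K.\<rho> = rho M f X"
  proof -
    have t: "distr M K.Q (\<lambda>\<omega>. (X 1 1 \<omega>, X 2 1 \<omega>, X 3 1 \<omega>)) = K.Q" by (rule triple_distr) auto
    have tm: "(\<lambda>\<omega>. (X 1 1 \<omega>, X 2 1 \<omega>, X 3 1 \<omega>)) \<in> measurable M K.Q" by (rule triple_measurable) auto
    have "K.\<rho> = (\<integral>y. K.comb 1 0 0 y * K.comb 0 1 0 y \<partial>K.Q)"
      by (rule K.comb_covariances(1)[symmetric])
    also have "\<dots> = (\<integral>y. K.comb 1 0 0 y * K.comb 0 1 0 y \<partial>distr M K.Q (\<lambda>\<omega>. (X 1 1 \<omega>, X 2 1 \<omega>, X 3 1 \<omega>)))"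
      by (simp only: t)
    also have "\<dots> = M.expectation (\<lambda>\<omega>. K.comb 1 0 0 (X 1 1 \<omega>, X 2 1 \<omega>, X 3 1 \<omega>) * K.comb 0 1 0 (X 1 1 \<omega>, X 2 1 \<omega>, X 3 1 \<omega>))"
      by (rule integral_distr[OF tm]) measurable
    also have "\<dots> = rho M f X" by (simp add: rho_def Zz K.comb_def)
    finally show ?thesis .
  qed
  define L where "L = (\<lambda>n. ln (real (p n)))"
  define I where "I n = {(i, j). 1 \<le> i \<and> i < j \<and> j \<le> p n}" for n
  define Y where "Y n \<omega> = (MAX (i, j) \<in> I n. 1 / sqrt (ln (real (p n))) * Tstat M f X n i j \<omega>)" for n \<omega>
  have L: "filterlim L at_top sequentially"
    unfolding L_def by (intro filterlim_compose[OF ln_at_top] filterlim_compose[OF filterlim_real_sequentially] assms(10))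
  have Ln: "(\<lambda>n. L n / real n) \<longlonglongrightarrow> 0"
    unfolding L_def using growth_condition_imp_ln_small[OF assms(10,12,15)] by simp
  have finI: "finite (I n)" for n
    by (rule finite_subset[of _ "{1..p n} \<times> {1..p n}"]) (auto simp: I_def)
  \<comment> \<open>Multiplication by \<open>L n\<close> turns the normalised statistics into the sums \<open>S\<close>.\<close>
  have TS: "L n * (1 / sqrt (ln (real (p n))) * Tstat M f X n i j \<omega>) = S (scale L n) n i j \<omega>" if "L n > 0" for n i j \<omega>
  proof -
    let ?sum = "\<Sum>l = 1..n. z (X i l \<omega>, X j l \<omega>)"
    have "L n * (1 / sqrt (L n) * (1 / sqrt (real n) * ?sum)) = (L n / sqrt (L n)) * (?sum / sqrt (real n))"
      by simp
    also have "L n / sqrt (L n) = sqrt (L n)" using that by (intro real_div_sqrt) simp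
    also have "sqrt (L n) * (?sum / sqrt (real n)) = S (scale L n) n i j \<omega>"
      by (simp add: S_def real_sqrt_divide)
    finally show ?thesis by (simp add: L_def Tstat_def Zz)
  qed
  have Ym: "Y n \<in> borel_measurable M" for n
  proof -
    have "Tstat M f X n i j \<in> borel_measurable M" if "1 \<le> i" "1 \<le> j" for i j
      unfolding Tstat_def Zz using that
      by (intro borel_measurable_times borel_measurable_sum z_entries_measurable) auto
    then have "(\<lambda>\<omega>. case e of (i, j) \<Rightarrow> 1 / sqrt (ln (real (p n))) * Tstat M f X n i j \<omega>) \<in> borel_measurable M"
      if "e \<in> I n" for e
      using that by (cases e) (auto simp: I_def)
    from borel_measurable_Max[OF finI this] show ?thesis
      unfolding Y_def by (simp add: case_prod_unfold)
  qed
  have "(\<lambda>n. M.prob {\<omega> \<in> space M. \<bar>Y n \<omega> - 2\<bar> > \<epsilon>}) \<longlonglongrightarrow> 0" if e: "\<epsilon> > 0" for \<epsilon>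
  proof -
    define \<tau> where "\<tau> = min 1 (\<epsilon> / 2)"
    have t: "0 < \<tau>" "\<tau> \<le> 1" "2 * \<tau> \<le> \<epsilon>" using e by (auto simp: \<tau>_def)
    define U where "U n = (\<Union>(i, j)\<in>I n. {\<omega>\<in>space M. (2 + \<epsilon>) * L n < S (scale L n) n i j \<omega>})" for n
    define D where "D n = {\<omega>\<in>space M. \<forall>i j. 1 \<le> i \<longrightarrow> i < j \<longrightarrow> j \<le> p n \<longrightarrow> S (scale L n) n i j \<omega> < (2 - 2 * \<tau>) * L n}" for n
    have Sm: "S (scale L n) n i j \<in> borel_measurable M" if "(i, j) \<in> I n" for n i j
      using that by (intro S_measurable) (auto simp: I_def)
    have Um: "U n \<in> M.events" for n
      unfolding U_def using finI Sm by (intro sets.finite_UN) (auto)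
    have Dm: "D n \<in> M.events" for n
    proof -
      have "D n = {\<omega>\<in>space M. \<forall>e\<in>I n. S (scale L n) n (fst e) (snd e) \<omega> < (2 - 2 * \<tau>) * L n}"
        by (auto simp: D_def I_def)
      also have "\<dots> \<in> M.events"
      proof (rule sets.sets_Collect_finite_All[OF _ finI])
        fix e assume "e \<in> I n"
        then have [measurable]: "S (scale L n) n (fst e) (snd e) \<in> borel_measurable M" by (intro Sm) simp
        show "{\<omega>\<in>space M. S (scale L n) n (fst e) (snd e) \<omega> < (2 - 2 * \<tau>) * L n} \<in> M.events" by measurable
      qed
      finally show ?thesis .
    qed
    have UD: "(\<lambda>n. M.prob (U n) + M.prob (D n)) \<longlonglongrightarrow> 0 + 0"
    proof (rule tendsto_add)
      show "(\<lambda>n. M.prob (U n)) \<longlonglongrightarrow> 0"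
        using max_upper[OF L[unfolded L_def] Ln[unfolded L_def] e] by (simp add: U_def I_def L_def)
      show "(\<lambda>n. M.prob (D n)) \<longlonglongrightarrow> 0"
        using max_lower[OF L[unfolded L_def] Ln[unfolded L_def] _ t(1,2)] assms(16) rho by (simp add: D_def L_def)
    qed
    have "\<forall>\<^sub>F n in sequentially. L n > 0" using L by (simp add: filterlim_at_top_dense)
    moreover have "\<forall>\<^sub>F n in sequentially. p n \<ge> 2" using assms(10) by (simp add: filterlim_at_top)
    ultimately have "\<forall>\<^sub>F n in sequentially. M.prob {\<omega> \<in> space M. \<bar>Y n \<omega> - 2\<bar> > \<epsilon>} \<le> M.prob (U n) + M.prob (D n)"
    proof eventually_elim
      case (elim n)
      have "(1, 2) \<in> I n" using elim by (simp add: I_def)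
      then have neI: "I n \<noteq> {}" by blast
      have "{\<omega> \<in> space M. \<bar>Y n \<omega> - 2\<bar> > \<epsilon>} \<subseteq> U n \<union> D n"
      proof
        fix \<omega> assume w: "\<omega> \<in> {\<omega> \<in> space M. \<bar>Y n \<omega> - 2\<bar> > \<epsilon>}"
        then consider "Y n \<omega> > 2 + \<epsilon>" | "Y n \<omega> < 2 - \<epsilon>" by force
        then show "\<omega> \<in> U n \<union> D n"
        proof cases
          case 1
          have "Y n \<omega> \<in> (\<lambda>(i, j). 1 / sqrt (ln (real (p n))) * Tstat M f X n i j \<omega>) ` I n"
            unfolding Y_def using finI neI by (intro Max_in) auto
          then obtain i j where ij: "(i, j) \<in> I n" "Y n \<omega> = 1 / sqrt (ln (real (p n))) * Tstat M f X n i j \<omega>"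
            by auto
          have "L n * (2 + \<epsilon>) < L n * Y n \<omega>" using 1 elim(1) by simp
          then have "(2 + \<epsilon>) * L n < S (scale L n) n i j \<omega>"
            unfolding ij(2) TS[OF elim(1)] by (simp add: mult.commute)
          then show ?thesis using ij(1) w by (auto simp: U_def)
        next
          case 2
          have "S (scale L n) n i j \<omega> < (2 - 2 * \<tau>) * L n" if "1 \<le> i" "i < j" "j \<le> p n" for i j
          proof -
            have "(i, j) \<in> I n" using that by (simp add: I_def)
            then have "1 / sqrt (ln (real (p n))) * Tstat M f X n i j \<omega> \<le> Y n \<omega>"
              unfolding Y_def using finI by (intro Max_ge) force+
            then have "1 / sqrt (ln (real (p n))) * Tstat M f X n i j \<omega> < 2 - 2 * \<tau>" using 2 t(3) by linarith
            from mult_strict_left_mono[OF this elim(1)] show ?thesis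
              unfolding TS[OF elim(1)] by (simp add: mult.commute)
          qed
          then show ?thesis using w by (auto simp: D_def)
        qed
      qed
      then have "M.prob {\<omega> \<in> space M. \<bar>Y n \<omega> - 2\<bar> > \<epsilon>} \<le> M.prob (U n \<union> D n)"
        using Um Dm by (intro M.finite_measure_mono) auto
      also have "\<dots> \<le> M.prob (U n) + M.prob (D n)" by (rule measure_Un_le[OF Um Dm])
      finally show ?case .
    qed
    moreover have "(\<lambda>n. M.prob (U n) + M.prob (D n)) \<longlonglongrightarrow> 0" using UD by simp
    ultimately show ?thesis by (rule tendsto_sandwich[OF always_eventually _ tendsto_const, rotated]) simp
  qed
  then have "tendsto_in_prob M Y 2" unfolding tendsto_in_prob_def using Ym by blast
  then show ?thesis unfolding Y_def[abs_def] I_def .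
qed

end
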